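(* Let $n>p$ and let $\mathcal G_L$ be the group of transformations of $\mathbb R^{n\times p}$ of the form $g(Y)=YA^T$ with $A\in\mathbb R^{p\times p}$ nonsingular. Let $\phi:\mathbb R^{n\times p}\to[0,1]$ be a (measurable) $\mathcal G_L$-invariant function such that $\mathrm E[\phi\mid I_p\otimes I_n]=\alpha$. Let $\Sigma\in\mathcal S_p^+$ and let $\Lambda$ be a fixed $n\times n$ positive definite diagonal matrix. If $\mathrm E[\phi\mid\Sigma\otimes E\Lambda E^T]\ge\alpha$ for all $E\in\mathcal O_n$, then $\mathrm E[\phi\mid\Sigma\otimes E\Lambda E^T]=\alpha$ for all $E\in\mathcal O_n$.
   Context: $\mathcal S_k^+$ is the set of $k\times k$ symmetric positive definite matrices and $\mathcal O_n$ is the set of $n\times n$ orthogonal matrices. For $\Sigma\in\mathcal S_p^+$ and $\Psi\in\mathcal S_n^+$, $\mathrm E[\phi\mid\Sigma\otimes\Psi]$ denotes the expectation of $\phi(Y)$ when $Y\sim N_{n\times p}(0,\Sigma\otimes\Psi)$, i.e. when $Y$ has the distribution of $\Psi^{1/2}Z\Sigma^{1/2}$ with $Z$ an $n\times p$ matrix of i.i.d. standard normal entries and symmetric square roots. $\phi$ is $\mathcal G_L$-invariant if $\phi(g(Y))=\phi(Y)$ for all $g\in\mathcal G_L$ and all $Y$. *)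

theory Defs
  imports "HOL-Probability.Probability"
begin

definition positive_definite :: "real^'k^'k \<Rightarrow> bool" where
  "positive_definite A \<longleftrightarrow> transpose A = A \<and> (\<forall>x. x \<noteq> 0 \<longrightarrow> x \<bullet> (A *v x) > 0)"

definition diagonal_matrix :: "real^'k^'k \<Rightarrow> bool" where
  "diagonal_matrix A \<longleftrightarrow> (\<forall>i j. i \<noteq> j \<longrightarrow> A $ i $ j = 0)"

(* Only meaningful for positive definite arguments, which have exactly one
   positive definite (in particular symmetric) square root. *)
definition sym_sqrt :: "real^'k^'k \<Rightarrow> real^'k^'k" where
  "sym_sqrt A = (THE R. positive_definite R \<and> R ** R = A)"

(* The type real^'p^'n consists of the matrices with CARD('n) rows and CARD('p)
   columns, i.e. n x p matrices. *)
definition std_normal_matrix :: "(real^'p^'n) measure" where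
  "std_normal_matrix =
     distr (\<Pi>\<^sub>M ij\<in>(UNIV :: ('n \<times> 'p) set). density lborel (\<lambda>x. ennreal (std_normal_density x)))
       borel (\<lambda>z. \<chi> i j. z (i, j))"

(* The law N(0, Sigma (x) Psi) of Psi^(1/2) Z Sigma^(1/2), with Psi the row covariance
   and Sigma the column covariance. *)
definition matrix_normal :: "real^'p^'p \<Rightarrow> real^'n^'n \<Rightarrow> (real^'p^'n) measure" where
  "matrix_normal \<Sigma> \<Psi> =
     distr std_normal_matrix borel (\<lambda>Z. sym_sqrt \<Psi> ** Z ** sym_sqrt \<Sigma>)"

definition normal_expectation :: "(real^'p^'n \<Rightarrow> real) \<Rightarrow> real^'p^'p \<Rightarrow> real^'n^'n \<Rightarrow> real" where
  "normal_expectation \<phi> \<Sigma> \<Psi> = integral\<^sup>L (matrix_normal \<Sigma> \<Psi>) \<phi>"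

definition G_L :: "(real^'p^'n \<Rightarrow> real^'p^'n) set" where
  "G_L = {g. \<exists>A :: real^'p^'p. invertible A \<and> g = (\<lambda>Y. Y ** transpose A)}"

definition invariant_under :: "('a \<Rightarrow> 'a) set \<Rightarrow> ('a \<Rightarrow> 'b) \<Rightarrow> bool" where
  "invariant_under G \<phi> \<longleftrightarrow> (\<forall>g\<in>G. \<forall>Y. \<phi> (g Y) = \<phi> Y)"

(* Both maps used in the pushforwards above are measurable, so distr does not
   degenerate and the laws are genuine probability measures. *)

lemma measurable_matrix_of_entries:
  "(\<lambda>z. \<chi> i j. z (i, j)) \<in>
     (\<Pi>\<^sub>M ij\<in>(UNIV :: ('n::finite \<times> 'p::finite) set).
        density lborel (\<lambda>x. ennreal (std_normal_density x))) \<rightarrow>\<^sub>M (borel :: (real^'p^'n) measure)"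
proof (subst borel_measurable_euclidean_space, intro ballI)
  fix b :: "real^'p^'n"
  let ?M = "\<Pi>\<^sub>M ij\<in>(UNIV :: ('n \<times> 'p) set). density lborel (\<lambda>x. ennreal (std_normal_density x))"
  have c: "(\<lambda>z. z (i, j)) \<in> borel_measurable ?M" for i j
  proof -
    have "(\<lambda>z. z (i, j)) \<in> ?M \<rightarrow>\<^sub>M density lborel (\<lambda>x. ennreal (std_normal_density x))"
      by (rule measurable_component_singleton) simp
    then show ?thesis by simp
  qed
  show "(\<lambda>z. (\<chi> i j. z (i, j)) \<bullet> b) \<in> borel_measurable ?M"
    unfolding inner_vec_def by (simp add: c)
qed

lemma measurable_two_sided_mult:
  "(\<lambda>Z :: real^'p^'n. A ** Z ** B) \<in> borel_measurable borel"
  by (rule borel_measurable_continuous_onI)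
     (auto intro!: continuous_intros simp: matrix_matrix_mult_def)

lemma prob_space_std_normal_matrix: "prob_space (std_normal_matrix :: (real^'p^'n) measure)"
  unfolding std_normal_matrix_def
  by (intro prob_space.prob_space_distr measurable_matrix_of_entries prob_space_PiM
        prob_space_normal_density) simp

lemma prob_space_matrix_normal:
  "prob_space (matrix_normal \<Sigma> \<Psi> :: (real^'p^'n) measure)"
  unfolding matrix_normal_def
  by (intro prob_space.prob_space_distr prob_space_std_normal_matrix)
     (simp add: std_normal_matrix_def measurable_two_sided_mult)

end

theory Submission
  imports Defs
begin

text \<open>
  By invariance, the expectation at \<open>E \<Lambda> E\<^sup>T\<close> equals \<open>f E = \<integral> \<phi> (E D Z)\<close> with \<open>Z\<close> standard normal
  and \<open>D = \<Lambda>\<^bsup>1/2\<^esup>\<close>. The Haar average of \<open>E \<mapsto> \<phi> (E Y)\<close> is the same for all \<open>Y\<close> of full column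
  rank: \<open>Y\<close> matters only through its column space, and the orthogonal group acts transitively on
  subspaces of a given dimension. Since \<open>Z\<close> and \<open>D Z\<close> have full column rank almost surely, Fubini
  shows that \<open>f\<close> has Haar average \<open>\<alpha>\<close>. As \<open>f \<ge> \<alpha>\<close>, it equals \<open>\<alpha>\<close> almost everywhere, and everywhere
  by continuity. Haar measure is realised as the law of the polar factor of a square Gaussian matrix.
\<close>

subsection \<open>Square roots of positive definite matrices\<close>

text \<open>Two obstacles shape the argument. Since \<open>\<phi>\<close> is merely measurable,
  \<open>f\<close> owes its continuity to the Gaussian density alone: the rotation has to be moved
  off \<open>\<phi>\<close> before any limit is taken. And passing from almost everywhere to
  everywhere on the orthogonal group would require that Haar measure charges open sets. This is
  avoided by staying in the space of square matrices:
  \<open>G \<mapsto> f (random_rotation G)\<close> is continuous on the open set of invertible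
  matrices, where Gaussian null sets are Lebesgue null sets, and a prescribed \<open>E\<close> is
  attained at \<open>G = transpose E\<close>. Of Haar measure only one-sided invariance enters,
  which the polar factor inherits from the Gaussian law. Continuity of the polar factor is the
  reason to prove \<open>sym_sqrt\<close> continuous, besides the existence and uniqueness that its
  definition by \<open>THE\<close> demands. Jacobians are never computed: a linear change of
  variables is known up to a constant, which is either fixed by total mass 1 or only has to be
  finite.\<close>

lemma inner_matrix_transpose:
  fixes A B :: "real^'p^'n"
  shows "transpose A \<bullet> transpose B = A \<bullet> B"
  unfolding inner_vec_def transpose_def inner_real_def vec_lambda_beta
  by (subst sum.swap) simp

lemma inner_transpose_matrix_vector:
  fixes A :: "real^'m^'n"
  shows "x \<bullet> (transpose A *v y) = (A *v x) \<bullet> y"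
  by (metis dot_lmul_matrix inner_commute transpose_matrix_vector)

lemma dot_symmetric_matrix:
  fixes A :: "real^'n^'n"
  assumes "transpose A = A"
  shows "x \<bullet> (A *v y) = (A *v x) \<bullet> y"
  by (metis assms inner_transpose_matrix_vector)

lemma quadratic_nonpos_imp_linear_zero:
  fixes a c :: real
  assumes "\<And>t. 2 * t * a + t\<^sup>2 * c \<le> 0"
  shows "a = 0"
proof (rule ccontr)
  assume "a \<noteq> 0"
  \<comment> \<open>At \<open>t = a / d\<close> the linear term dominates as soon as
    \<open>2 * d + c > 0\<close>.\<close>
  define d where "d = \<bar>c\<bar> + 1"
  have d: "d > 0" "2 * d + c > 0" by (auto simp: d_def)
  have "2 * (a / d) * a + (a / d)\<^sup>2 * c = (a / d)\<^sup>2 * (2 * d + c)"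
    using d by (simp add: field_simps power2_eq_square)
  moreover have "(a / d)\<^sup>2 * (2 * d + c) > 0" using d \<open>a \<noteq> 0\<close> by simp
  ultimately show False using assms[of "a / d"] by simp
qed

text \<open>Spectral theorem by induction over invariant subspaces: a maximiser \<open>v\<close> of
  the quadratic form on the unit sphere of \<open>S\<close> is an eigenvector, and by symmetry its
  orthogonal complement in \<open>S\<close> is again invariant.\<close>

lemma symmetric_eigenbasis_subspace:
  fixes A :: "real^'n^'n"
  assumes sym: "transpose A = A"
  shows "subspace S \<Longrightarrow> (*v) A ` S \<subseteq> S \<Longrightarrow>
    \<exists>B. finite B \<and> pairwise orthogonal B \<and> span B = S \<and>
      (\<forall>b\<in>B. norm b = 1 \<and> (\<exists>l. A *v b = l *\<^sub>R b))"
proof (induction "dim S" arbitrary: S rule: less_induct)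
  case less
  show ?case
  proof (cases "S \<subseteq> {0}")
    case True
    then have "S = {0}" using subspace_0[OF less.prems(1)] by auto
    then show ?thesis by (intro exI[of _ "{}"]) auto
  next
    case False
    then obtain y where y: "y \<in> S" "y \<noteq> 0" by auto
    have "compact (S \<inter> sphere 0 1)"
      by (simp add: closed_Int_compact closed_subspace less.prems(1))
    moreover have "y /\<^sub>R norm y \<in> S \<inter> sphere 0 1"
      using y less.prems(1) by (simp add: subspace_scale)
    moreover have "continuous_on (S \<inter> sphere 0 1) (\<lambda>x. x \<bullet> (A *v x))"
      by (intro continuous_intros linear_continuous_on) (simp add: linear_conv_bounded_linear[symmetric])
    ultimately have "\<exists>x\<in>S \<inter> sphere 0 1. \<forall>y\<in>S \<inter> sphere 0 1. y \<bullet> (A *v y) \<le> x \<bullet> (A *v x)"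
      by (intro continuous_attains_sup) blast+
    then obtain v where v: "v \<in> S" "norm v = 1"
      and vmax: "\<And>x. x \<in> S \<Longrightarrow> norm x = 1 \<Longrightarrow> x \<bullet> (A *v x) \<le> v \<bullet> (A *v v)"
      by auto
    define l where "l = v \<bullet> (A *v v)"
    define w where "w = A *v v - l *\<^sub>R v"
    have w: "w \<in> S" unfolding w_def
      using less.prems v by (intro subspace_diff subspace_scale) auto
    have quad: "x \<bullet> (A *v x) \<le> l * (x \<bullet> x)" if "x \<in> S" for x
    proof (cases "x = 0")
      case False
      have "(x /\<^sub>R norm x) \<bullet> (A *v (x /\<^sub>R norm x)) \<le> l" unfolding l_def
        using that less.prems(1) False by (intro vmax) (auto simp: subspace_scale)
      then show ?thesis using False
        by (simp add: matrix_vector_mult_scaleR field_simps power2_norm_eq_inner[symmetric] power2_eq_square)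
    qed simp
    \<comment> \<open>First-order condition at the maximiser: moving \<open>v\<close> in the
      direction of the residual \<open>w\<close> changes the form minus \<open>l\<close> times the
      squared norm by \<open>2 * t * (w \<bullet> w)\<close> to first order.\<close>
    have "w \<bullet> w = 0"
    proof (rule quadratic_nonpos_imp_linear_zero)
      fix t :: real
      have "v + t *\<^sub>R w \<in> S" using v w less.prems(1) by (intro subspace_add subspace_scale) auto
      from quad[OF this]
      have "v \<bullet> (A *v v) + t * (v \<bullet> (A *v w)) + t * (w \<bullet> (A *v v)) + t\<^sup>2 * (w \<bullet> (A *v w))
         \<le> l * (v \<bullet> v + 2 * t * (w \<bullet> v) + t\<^sup>2 * (w \<bullet> w))"
        by (simp add: matrix_vector_right_distrib matrix_vector_mult_scaleR inner_add_left
            inner_add_right inner_commute algebra_simps power2_eq_square)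
      moreover have "v \<bullet> (A *v w) = w \<bullet> (A *v v)"
        by (metis dot_symmetric_matrix[OF sym] inner_commute)
      moreover have "w \<bullet> (A *v v) = w \<bullet> w + l * (w \<bullet> v)"
        unfolding w_def by (simp add: inner_diff_right algebra_simps inner_diff_left)
      moreover have "v \<bullet> v = 1" using v(2) by (simp add: norm_eq_1)
      ultimately show "2 * t * (w \<bullet> w) + t\<^sup>2 * (w \<bullet> (A *v w) - l * (w \<bullet> w)) \<le> 0"
        using l_def by (simp add: algebra_simps)
    qed
    then have Av: "A *v v = l *\<^sub>R v" by (simp add: w_def)
    define S' where "S' = S \<inter> {x. v \<bullet> x = 0}"
    have S': "subspace S'" unfolding S'_def
      by (intro subspace_inter less.prems(1) subspace_hyperplane)
    have "v \<notin> S'" using v(2) by (auto simp: S'_def)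
    then have "S' \<subset> S" using v(1) S'_def by blast
    then have "dim S' < dim S"
      by (intro dim_psubset) (simp add: S' less.prems(1) span_eq_iff[THEN iffD2])
    moreover have "(*v) A ` S' \<subseteq> S'"
    proof -
      have "v \<bullet> (A *v x) = l * (v \<bullet> x)" for x
        using dot_symmetric_matrix[OF sym, of v x] by (simp add: Av)
      then show ?thesis using less.prems(2) by (auto simp: S'_def)
    qed
    ultimately obtain B where B: "finite B" "pairwise orthogonal B" "span B = S'"
      "\<forall>b\<in>B. norm b = 1 \<and> (\<exists>l. A *v b = l *\<^sub>R b)"
      using less.hyps S' by metis
    have "span (insert v B) = S"
    proof (intro equalityI subsetI)
      fix x assume "x \<in> span (insert v B)"
      moreover have "insert v B \<subseteq> S" using v(1) B(3) span_superset[of B] by (auto simp: S'_def)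
      ultimately show "x \<in> S" using less.prems(1) span_minimal by blast
    next
      fix x assume "x \<in> S"
      then have "x - (v \<bullet> x) *\<^sub>R v \<in> S'"
        using v less.prems(1)
        by (auto simp: S'_def subspace_diff subspace_scale inner_diff_right norm_eq_1)
      then have "x - (v \<bullet> x) *\<^sub>R v \<in> span (insert v B)"
        using B(3) span_mono[of B "insert v B"] by auto
      then have "(x - (v \<bullet> x) *\<^sub>R v) + (v \<bullet> x) *\<^sub>R v \<in> span (insert v B)"
        by (intro span_add span_scale) (auto intro: span_base)
      then show "x \<in> span (insert v B)" by simp
    qed
    moreover have "pairwise orthogonal (insert v B)"
    proof -
      have "v \<bullet> b = 0" if "b \<in> B" for b
        using that B(3) span_superset[of B] by (auto simp: S'_def)
      then show ?thesis using B(2)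
        by (auto simp: pairwise_insert orthogonal_def inner_commute)
    qed
    ultimately show ?thesis using B v Av by (intro exI[of _ "insert v B"]) auto
  qed
qed

text \<open>The constant is the minimum of the quadratic form on the compact unit sphere. It makes
  the bound on differences of square roots quantitative.\<close>

lemma positive_definite_lower_bound:
  fixes A :: "real^'n^'n"
  assumes "positive_definite A"
  obtains c where "c > 0" "\<And>x. c * (x \<bullet> x) \<le> x \<bullet> (A *v x)"
proof -
  have "continuous_on (sphere 0 1) (\<lambda>x. x \<bullet> (A *v x))"
    by (intro continuous_intros linear_continuous_on) (simp add: linear_conv_bounded_linear[symmetric])
  moreover have "(axis undefined 1 :: real^'n) \<in> sphere 0 1" by simp
  ultimately obtain v :: "real^'n" where v: "norm v = 1"
    and vmin: "\<And>x. norm x = 1 \<Longrightarrow> v \<bullet> (A *v v) \<le> x \<bullet> (A *v x)"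
    using continuous_attains_inf[of "sphere 0 1" "\<lambda>x. x \<bullet> (A *v x)"] by force
  show ?thesis
  proof
    have "v \<noteq> 0" using v by auto
    then show "v \<bullet> (A *v v) > 0" using assms unfolding positive_definite_def by blast
    show "v \<bullet> (A *v v) * (x \<bullet> x) \<le> x \<bullet> (A *v x)" for x
    proof (cases "x = 0")
      case False
      then have "v \<bullet> (A *v v) \<le> (x /\<^sub>R norm x) \<bullet> (A *v (x /\<^sub>R norm x))"
        by (intro vmin) auto
      then show ?thesis using False
        by (simp add: matrix_vector_mult_scaleR field_simps power2_norm_eq_inner[symmetric] power2_eq_square)
    qed simp
  qed
qed

lemma positive_definite_invertible:
  fixes A :: "real^'n^'n"
  assumes "positive_definite A"
  shows "invertible A"
  using assms unfolding invertible_left_inverse matrix_left_invertible_ker positive_definite_def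
  by (metis inner_zero_right less_irrefl)

lemma positive_definite_gram:
  fixes A :: "real^'p^'n"
  assumes "inj ((*v) A)"
  shows "positive_definite (transpose A ** A)"
proof -
  have "A *v x = 0 \<Longrightarrow> x = 0" for x
    using injD[OF assms, of x 0] by simp
  moreover have "x \<bullet> ((transpose A ** A) *v x) = (A *v x) \<bullet> (A *v x)" for x
    by (simp add: matrix_vector_mul_assoc[symmetric] inner_transpose_matrix_vector
        del: transpose_matrix_vector)
  ultimately show ?thesis unfolding positive_definite_def
    by (auto simp: matrix_transpose_mul)
qed

lemma positive_definite_mat_1: "positive_definite (mat 1 :: real^'n^'n)"
  by (simp add: positive_definite_def)

lemma positive_definite_sqrt_exists:
  fixes A :: "real^'n^'n"
  assumes "positive_definite A"
  shows "\<exists>R. positive_definite R \<and> R ** R = A"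
proof -
  have sym: "transpose A = A" using assms by (simp add: positive_definite_def)
  obtain B where B: "finite B" "pairwise orthogonal B" "span B = UNIV"
      "\<And>b. b\<in>B \<Longrightarrow> norm b = 1 \<and> (\<exists>l. A *v b = l *\<^sub>R b)"
    using symmetric_eigenbasis_subspace[OF sym, of UNIV] by auto
  obtain l where l: "\<And>b. b \<in> B \<Longrightarrow> A *v b = l b *\<^sub>R b" using B(4) by metis
  have ortho: "b \<bullet> b' = (if b = b' then 1 else 0)" if "b \<in> B" "b' \<in> B" for b b'
    using that B(2,4) by (auto simp: pairwise_def orthogonal_def norm_eq_1)
  have lpos: "l b > 0" if "b \<in> B" for b
  proof -
    have "b \<noteq> 0" using B(4)[OF that] by auto
    then have "b \<bullet> (A *v b) > 0" using assms by (simp add: positive_definite_def)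
    then show ?thesis using l[OF that] ortho[OF that that] by simp
  qed
  define r where "r = (\<lambda>x. \<Sum>b\<in>B. (sqrt (l b) * (b \<bullet> x)) *\<^sub>R b)"
  have lin: "linear r" unfolding r_def
    by (intro linearI) (simp_all add: inner_add_right algebra_simps sum.distrib scaleR_sum_right)
  define R where "R = matrix r"
  have Rv: "R *v x = r x" for x by (simp add: R_def matrix_works lin)
  have rb: "r b = sqrt (l b) *\<^sub>R b" if "b \<in> B" for b
  proof -
    have "r b = (\<Sum>b'\<in>B. if b' = b then sqrt (l b) *\<^sub>R b else 0)"
      unfolding r_def using that by (intro sum.cong) (auto simp: ortho)
    then show ?thesis using B(1) that by simp
  qed
  have xr: "x \<bullet> r y = (\<Sum>b\<in>B. sqrt (l b) * (b \<bullet> x) * (b \<bullet> y))" for x y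
    unfolding r_def by (simp add: inner_sum_right inner_commute mult_ac)
  have "(R ** R) *v x = A *v x" for x
  proof (rule linear_eq_on_span[of "(*v) (R ** R)" "(*v) A" B])
    show "x \<in> span B" using B(3) by simp
    show "(R ** R) *v b = A *v b" if "b \<in> B" for b
      using that lpos[OF that]
      by (simp add: matrix_vector_mul_assoc[symmetric] Rv rb linear_scale[OF lin] l)
  qed auto
  then have "R ** R = A" by (simp add: matrix_eq)
  moreover have "transpose R = R"
  proof -
    have "x \<bullet> (transpose R *v y) = x \<bullet> (R *v y)" for x y
      by (simp add: inner_transpose_matrix_vector Rv inner_commute[of "r x"] xr mult_ac
          del: transpose_matrix_vector)
    then have "transpose R *v y = R *v y" for y by (metis vector_eq_ldot)
    then show ?thesis by (simp add: matrix_eq)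
  qed
  moreover have "x \<bullet> (R *v x) > 0" if "x \<noteq> 0" for x
  proof -
    have ge: "sqrt (l b) * (b \<bullet> x) * (b \<bullet> x) \<ge> 0" if "b \<in> B" for b
      using lpos[OF that] by (simp add: mult.assoc)
    \<comment> \<open>The form \<open>x \<bullet> r x\<close> is a sum of nonnegative terms, so one
      nonvanishing coordinate suffices; there is one because \<open>B\<close> spans.\<close>
    have "\<exists>b\<in>B. b \<bullet> x \<noteq> 0"
    proof (rule ccontr)
      assume none: "\<not> ?thesis"
      have "orthogonal x y" if "y \<in> span B" for y
        by (rule orthogonal_to_span[OF that]) (use none in \<open>simp add: orthogonal_def inner_commute\<close>)
      then show False using B(3) \<open>x \<noteq> 0\<close> by (metis UNIV_I orthogonal_self)
    qed
    then obtain b where b: "b \<in> B" "b \<bullet> x \<noteq> 0" by auto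
    have "0 < sqrt (l b) * (b \<bullet> x) * (b \<bullet> x)"
    proof -
      have "0 < (b \<bullet> x)\<^sup>2" using b(2) by simp
      with lpos[OF b(1)] have "0 < sqrt (l b) * (b \<bullet> x)\<^sup>2"
        by (intro mult_pos_pos) simp_all
      then show ?thesis by (simp only: power2_eq_square mult.assoc)
    qed
    also have "\<dots> \<le> x \<bullet> (R *v x)" unfolding Rv xr
      using b(1) B(1) ge by (intro member_le_sum) auto
    finally show ?thesis .
  qed
  ultimately show ?thesis unfolding positive_definite_def by blast
qed

text \<open>The Frobenius product splits over rows, and a symmetric \<open>S\<close> acts on each
  row of \<open>X\<close> as on a vector.\<close>

lemma inner_matrix_mult_symmetric_ge:
  fixes X :: "real^'n^'m" and S :: "real^'n^'n"
  assumes "transpose S = S" "\<And>x. c * (x \<bullet> x) \<le> x \<bullet> (S *v x)"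
  shows "c * (X \<bullet> X) \<le> X \<bullet> (X ** S)"
proof -
  have "(X ** S) $ i = S *v (X $ i)" for i
  proof -
    have "S $ k $ j = S $ j $ k" for j k
      using arg_cong[OF assms(1), of "\<lambda>M. M $ j $ k"] by (simp add: transpose_def)
    then show ?thesis
      by (simp add: vec_eq_iff matrix_matrix_mult_def matrix_vector_mult_def mult.commute)
  qed
  then have "X \<bullet> (X ** S) = (\<Sum>i\<in>UNIV. X $ i \<bullet> (S *v (X $ i)))"
    by (simp add: inner_vec_def[of X])
  moreover have "c * (X \<bullet> X) = (\<Sum>i\<in>UNIV. c * (X $ i \<bullet> X $ i))"
    by (simp add: inner_vec_def[of X] sum_distrib_left)
  ultimately show ?thesis using assms(2) by (simp add: sum_mono)
qed

lemma matrix_diff_ldistrib: "A ** (B - C) = A ** B - A ** (C :: real^'p^'n)"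
  by (simp add: matrix_matrix_mult_def vec_eq_iff algebra_simps sum_subtractf)

lemma matrix_diff_rdistrib: "(B - C) ** A = B ** A - C ** (A :: real^'p^'n)"
  by (simp add: matrix_matrix_mult_def vec_eq_iff algebra_simps sum_subtractf)

text \<open>Pair \<open>R\<^sup>2 - S\<^sup>2 = R D + D S\<close> with \<open>D = R - S\<close> in the Frobenius inner product.\<close>

lemma sqrt_matrix_lipschitz:
  fixes R S :: "real^'n^'n"
  assumes R: "transpose R = R" "\<And>x. 0 \<le> x \<bullet> (R *v x)"
    and S: "transpose S = S" "\<And>x. c * (x \<bullet> x) \<le> x \<bullet> (S *v x)"
  shows "c * norm (R - S) \<le> norm (R ** R - S ** S)"
proof -
  define D where "D = R - S"
  have D: "transpose D = D" using R(1) S(1) by (simp add: D_def transpose_def vec_eq_iff)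
  have eq: "R ** R - S ** S = R ** D + D ** S"
    unfolding D_def matrix_diff_ldistrib matrix_diff_rdistrib by simp
  \<comment> \<open>Transposition preserves the Frobenius product and brings \<open>R\<close> to the
    right of \<open>D\<close>, where the row-wise bound applies.\<close>
  have "D \<bullet> (R ** D) = D \<bullet> (D ** R)"
    by (metis D R(1) inner_matrix_transpose matrix_transpose_mul)
  moreover have "0 \<le> D \<bullet> (D ** R)"
    using inner_matrix_mult_symmetric_ge[of R 0 D] R by simp
  moreover have "c * (D \<bullet> D) \<le> D \<bullet> (D ** S)"
    by (rule inner_matrix_mult_symmetric_ge[OF S])
  ultimately have "c * (D \<bullet> D) \<le> D \<bullet> (R ** R - S ** S)"
    unfolding eq by (simp add: inner_add_right)
  also have "\<dots> \<le> norm D * norm (R ** R - S ** S)" by (rule norm_cauchy_schwarz)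
  finally have "norm D * (c * norm D) \<le> norm D * norm (R ** R - S ** S)"
    by (simp add: power2_norm_eq_inner[symmetric] power2_eq_square mult_ac)
  then show ?thesis unfolding D_def[symmetric]
    by (cases "norm D = 0") (simp_all add: mult_le_cancel_left)
qed

lemma positive_definite_sqrt_unique:
  fixes R S :: "real^'n^'n"
  assumes "positive_definite R" "positive_definite S" "R ** R = S ** S"
  shows "R = S"
proof -
  obtain c where c: "c > 0" "\<And>x. c * (x \<bullet> x) \<le> x \<bullet> (S *v x)"
    using positive_definite_lower_bound[OF assms(2)] by metis
  have "0 \<le> x \<bullet> (R *v x)" for x
    using assms(1) by (cases "x = 0") (auto simp: positive_definite_def less_imp_le)
  then have "c * norm (R - S) \<le> norm (R ** R - S ** S)"
    using assms c by (intro sqrt_matrix_lipschitz) (auto simp: positive_definite_def)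
  then show ?thesis using c(1) assms(3) by (simp add: mult_le_0_iff)
qed

lemma sym_sqrt:
  fixes A :: "real^'n^'n"
  assumes "positive_definite A"
  shows "positive_definite (sym_sqrt A)" "sym_sqrt A ** sym_sqrt A = A"
proof -
  have "\<exists>!R. positive_definite R \<and> R ** R = A"
    using positive_definite_sqrt_exists[OF assms] positive_definite_sqrt_unique by blast
  from theI'[OF this] show "positive_definite (sym_sqrt A)" "sym_sqrt A ** sym_sqrt A = A"
    by (simp_all add: sym_sqrt_def)
qed

lemma sym_sqrt_eqI:
  fixes A R :: "real^'n^'n"
  assumes "positive_definite R" "R ** R = A"
  shows "sym_sqrt A = R"
  unfolding sym_sqrt_def using assms positive_definite_sqrt_unique by blast

text \<open>The Lipschitz constant comes from the root of \<open>A\<close> alone, the other root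
  only has to be nonnegative; hence one radius \<open>c * e\<close> serves all
  \<open>B\<close>.\<close>

lemma continuous_on_sym_sqrt:
  "continuous_on {A. positive_definite A} (sym_sqrt :: real^'n^'n \<Rightarrow> _)"
  unfolding continuous_on_iff
proof (intro ballI allI impI)
  fix A :: "real^'n^'n" and e :: real
  assume "A \<in> {A. positive_definite A}" "e > 0"
  then have A: "positive_definite A" by simp
  obtain c where c: "c > 0" "\<And>x. c * (x \<bullet> x) \<le> x \<bullet> (sym_sqrt A *v x)"
    using positive_definite_lower_bound[OF sym_sqrt(1)[OF A]] by metis
  have "dist (sym_sqrt B) (sym_sqrt A) < e" if B: "positive_definite B" and d: "dist B A < c * e" for B
  proof -
    have "0 \<le> x \<bullet> (sym_sqrt B *v x)" for x
      using sym_sqrt(1)[OF B] by (cases "x = 0") (auto simp: positive_definite_def less_imp_le)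
    then have "c * norm (sym_sqrt B - sym_sqrt A)
        \<le> norm (sym_sqrt B ** sym_sqrt B - sym_sqrt A ** sym_sqrt A)"
      using sym_sqrt(1)[OF A] sym_sqrt(1)[OF B] c
      by (intro sqrt_matrix_lipschitz) (auto simp: positive_definite_def)
    then have "c * dist (sym_sqrt B) (sym_sqrt A) < c * e"
      using d by (simp add: sym_sqrt(2)[OF A] sym_sqrt(2)[OF B] dist_norm)
    then show ?thesis using c(1) by simp
  qed
  then show "\<exists>d>0. \<forall>x'\<in>{A. positive_definite A}. dist x' A < d \<longrightarrow> dist (sym_sqrt x') (sym_sqrt A) < e"
    using c(1) \<open>e > 0\<close> by (intro exI[of _ "c * e"]) auto
qed

subsection \<open>The standard normal law as a density\<close>

text \<open>Evaluate \<open>\<integral>\<integral> 1\<^sub>A(x) 1\<^sub>B(y + x)\<close> with \<open>B\<close> the unit cube in two ways, using the invariance of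
  either measure.\<close>

lemma translation_invariant_measure_eq_lborel:
  fixes M :: "'a::euclidean_space measure"
  assumes sets[measurable_cong]: "sets M = sets borel" and fin: "sigma_finite_measure M"
    and trans: "\<And>t. distr M borel ((+) t) = M"
  shows "\<exists>c. M = density lborel (\<lambda>_. c)"
proof -
  interpret M: sigma_finite_measure M by fact
  interpret P: pair_sigma_finite M lborel ..
  define B where "B = box (0::'a) One"
  have B[measurable]: "B \<in> sets borel" by (simp add: B_def)
  have B1: "emeasure lborel B = 1"
    by (simp add: B_def emeasure_lborel_box_eq)
  have shift: "(\<integral>\<^sup>+x. F (t + x) \<partial>M) = (\<integral>\<^sup>+x. F x \<partial>M)" if [measurable]: "F \<in> borel_measurable borel" for F and t :: 'a
    by (subst (2) trans[of t, symmetric], subst nn_integral_distr) (auto simp: sets)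
  have lshift: "(\<integral>\<^sup>+y. indicator B (y + x) \<partial>lborel) = (1::ennreal)" for x :: 'a
  proof -
    have "(\<integral>\<^sup>+y. indicator B (x + y) \<partial>lborel) = (\<integral>\<^sup>+y. indicator B y \<partial>distr lborel borel ((+) x))"
      by (subst nn_integral_distr) auto
    then show ?thesis using B1 by (simp add: lborel_distr_plus add.commute)
  qed
  have lreflect: "(\<integral>\<^sup>+y. indicator A (x - y) \<partial>lborel) = emeasure lborel A"
    if [measurable]: "A \<in> sets borel" for A and x :: 'a
  proof -
    have "lborel = distr lborel borel (\<lambda>y. x - y)"
      using lborel_affine[of "-1" x] by (simp add: density_1)
    from arg_cong[OF this, of "\<lambda>M. emeasure M A"]
    have "emeasure lborel A = (\<integral>\<^sup>+y. indicator A y \<partial>distr lborel borel (\<lambda>y. x - y))"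
      by simp
    also have "\<dots> = (\<integral>\<^sup>+y. indicator A (x - y) \<partial>lborel)"
      by (subst nn_integral_distr) auto
    finally show ?thesis by simp
  qed
  show ?thesis
  proof (intro exI[of _ "emeasure M B"] measure_eqI)
    fix A assume "A \<in> sets M"
    then have A[measurable]: "A \<in> sets borel" by (simp add: sets)
    have "emeasure M A = (\<integral>\<^sup>+x. indicator A x * (\<integral>\<^sup>+y. indicator B (y + x) \<partial>lborel) \<partial>M)"
      by (simp add: lshift sets)
    also have "\<dots> = (\<integral>\<^sup>+x. (\<integral>\<^sup>+y. indicator A x * indicator B (y + x) \<partial>lborel) \<partial>M)"
      by (subst nn_integral_cmult) auto
    also have "\<dots> = (\<integral>\<^sup>+y. (\<integral>\<^sup>+x. indicator A x * indicator B (y + x) \<partial>M) \<partial>lborel)"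
      by (rule P.Fubini'[symmetric]) measurable
    \<comment> \<open>Shifting \<open>x\<close> by \<open>-y\<close> moves the dependence on
      \<open>y\<close> from the cube to \<open>A\<close>, so that after the next exchange Lebesgue
      measure sees only \<open>A\<close> and \<open>M\<close> only the cube.\<close>
    also have "\<dots> = (\<integral>\<^sup>+y. (\<integral>\<^sup>+x. indicator A (x - y) * indicator B x \<partial>M) \<partial>lborel)"
    proof (rule nn_integral_cong)
      fix y :: 'a
      show "(\<integral>\<^sup>+x. indicator A x * indicator B (y + x) \<partial>M)
          = (\<integral>\<^sup>+x. indicator A (x - y) * indicator B x \<partial>M)"
        using shift[of "\<lambda>x. indicator A x * indicator B (y + x)" "-y", symmetric] by simp
    qed
    also have "\<dots> = (\<integral>\<^sup>+x. (\<integral>\<^sup>+y. indicator A (x - y) * indicator B x \<partial>lborel) \<partial>M)"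
      by (rule P.Fubini') measurable
    also have "\<dots> = (\<integral>\<^sup>+x. emeasure lborel A * indicator B x \<partial>M)"
      by (subst nn_integral_multc) (auto simp: lreflect)
    also have "\<dots> = emeasure lborel A * emeasure M B"
      by (simp add: nn_integral_cmult_indicator sets)
    finally show "emeasure M A = emeasure (density lborel (\<lambda>_. emeasure M B)) A"
      by (simp add: emeasure_density_const mult.commute)
  qed (simp add: sets)
qed

lemma borel_measurable_linear:
  fixes T :: "'a::euclidean_space \<Rightarrow> 'b::euclidean_space"
  assumes "linear T"
  shows "T \<in> borel_measurable borel"
  by (intro borel_measurable_continuous_onI linear_continuous_on) (simp add: assms linear_conv_bounded_linear[symmetric])

text \<open>The image measure is translation invariant because
  \<open>t + T x = T (T' t + x)\<close>, and sigma-finite because preimages of balls under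
  \<open>T\<close> are bounded.\<close>

lemma lborel_distr_linear_isomorphism:
  fixes T T' :: "'a::euclidean_space \<Rightarrow> 'a"
  assumes lin: "linear T" "linear T'" and inv: "\<And>x. T (T' x) = x" "\<And>x. T' (T x) = x"
  shows "\<exists>c. distr lborel borel T = density lborel (\<lambda>_. c)"
proof (rule translation_invariant_measure_eq_lborel)
  have T[measurable]: "T \<in> borel_measurable borel" "T' \<in> borel_measurable borel"
    using lin by (auto intro: borel_measurable_linear)
  show "sigma_finite_measure (distr lborel borel T)"
  proof
    have "emeasure (distr lborel borel T) (ball 0 (real n)) < \<infinity>" for n
    proof -
      have "T -` ball 0 (real n) = T' ` ball 0 (real n)" 
        by (auto simp: inv intro!: image_eqI[where f = T' and x = "T _"])
      moreover have "bounded (T' ` ball 0 (real n))"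
        by (intro bounded_linear_image) (auto simp: lin linear_conv_bounded_linear[symmetric])
      ultimately show ?thesis
        using emeasure_bounded_finite[of "T' ` ball 0 (real n)"] by (simp add: emeasure_distr)
    qed
    then show "\<exists>A. countable A \<and> A \<subseteq> sets (distr lborel borel T) \<and>
        \<Union> A = space (distr lborel borel T) \<and> (\<forall>a\<in>A. emeasure (distr lborel borel T) a \<noteq> \<infinity>)"
      by (intro exI[of _ "range (\<lambda>n::nat. ball 0 (real n))"])
         (auto simp: reals_Archimedean2 less_top)
  qed
  show "distr (distr lborel borel T) borel ((+) t) = distr lborel borel T" for t
  proof -
    have "distr (distr lborel borel T) borel ((+) t) = distr lborel borel (\<lambda>x. T (T' t + x))"
      by (subst distr_distr) (auto simp: comp_def linear_add[OF lin(1)] inv)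
    also have "\<dots> = distr (distr lborel borel ((+) (T' t))) borel T"
      by (subst distr_distr) (auto simp: comp_def)
    finally show ?thesis by (simp add: lborel_distr_plus)
  qed
qed simp

section \<open>Lebesgue and Gaussian measure on matrices as product measures\<close>

lemma Basis_matrix:
  "(Basis :: (real^'p^'n) set) = (\<lambda>(i, j). axis i (axis j 1)) ` UNIV"
  by (auto simp: Basis_vec_def image_iff)

lemma inj_matrix_basis: "inj (\<lambda>(i, j). axis i (axis j (1::real)) :: real^'p^'n)"
  by (auto simp: inj_on_def axis_eq_axis)

lemma distr_PiM_lborel_matrix:
  "(lborel :: (real^'p^'n) measure) =
     distr (\<Pi>\<^sub>M ij\<in>(UNIV :: ('n \<times> 'p) set). lborel) borel (\<lambda>z. \<chi> i j. z (i, j))"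
proof (rule lborel_eqI)
  interpret product_sigma_finite "\<lambda>ij::'n \<times> 'p. lborel :: real measure" by standard
  let ?mat = "\<lambda>z. (\<chi> i j. z (i, j)) :: real^'p^'n"
  have sets_eq: "sets (\<Pi>\<^sub>M ij\<in>(UNIV :: ('n \<times> 'p) set). density lborel (\<lambda>x. ennreal (std_normal_density x)))
      = sets (\<Pi>\<^sub>M ij\<in>(UNIV :: ('n \<times> 'p) set). lborel)"
    by (intro sets_PiM_cong) auto
  have meas: "?mat \<in> (\<Pi>\<^sub>M ij\<in>(UNIV :: ('n \<times> 'p) set). lborel) \<rightarrow>\<^sub>M borel"
    by (subst measurable_cong_sets[OF sets_eq[symmetric] refl]) (rule measurable_matrix_of_entries)
  fix l u :: "real^'p^'n"
  assume le: "\<And>b. b \<in> Basis \<Longrightarrow> l \<bullet> b \<le> u \<bullet> b"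
  have le': "l $ i $ j \<le> u $ i $ j" for i j
    using le[of "axis i (axis j 1)"] by (force simp: Basis_matrix inner_axis)
  have "?mat -` box l u \<inter> space (\<Pi>\<^sub>M ij\<in>UNIV. lborel)
      = (\<Pi>\<^sub>E ij\<in>UNIV. {l $ fst ij $ snd ij <..< u $ fst ij $ snd ij})"
    by (auto simp: box_def Basis_matrix inner_axis space_PiM PiE_iff)
  then have "emeasure (distr (\<Pi>\<^sub>M ij\<in>UNIV. lborel) borel ?mat) (box l u)
      = emeasure (\<Pi>\<^sub>M ij\<in>UNIV. lborel) (\<Pi>\<^sub>E ij\<in>UNIV. {l $ fst ij $ snd ij <..< u $ fst ij $ snd ij})"
    using meas by (simp add: emeasure_distr)
  also have "\<dots> = (\<Prod>ij\<in>UNIV. emeasure lborel {l $ fst ij $ snd ij <..< u $ fst ij $ snd ij})"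
    by (rule emeasure_PiM) auto
  also have "\<dots> = (\<Prod>ij\<in>UNIV. ennreal ((u - l) \<bullet> (\<lambda>(i, j). axis i (axis j 1)) ij))"
    by (intro prod.cong) (auto simp: le' inner_axis)
  also have "\<dots> = ennreal (\<Prod>ij\<in>UNIV. (u - l) \<bullet> (\<lambda>(i, j). axis i (axis j 1)) ij)"
    by (rule prod_ennreal) (auto simp: le' inner_axis)
  also have "\<dots> = (\<Prod>b\<in>Basis. (u - l) \<bullet> b)"
    unfolding Basis_matrix by (subst prod.reindex[OF inj_matrix_basis]) (simp add: comp_def)
  finally show "emeasure (distr (\<Pi>\<^sub>M ij\<in>UNIV. lborel) borel ?mat) (box l u) = (\<Prod>b\<in>Basis. (u - l) \<bullet> b)" .
qed simp

text \<open>Both sides agree on rectangles, where the integral of a product of one-variable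
  functions factors.\<close>

lemma PiM_density:
  fixes M :: "'a measure" and f :: "'a \<Rightarrow> ennreal"
  assumes I: "finite I" and M: "sigma_finite_measure M" "sigma_finite_measure (density M f)"
    and f[measurable]: "f \<in> borel_measurable M"
  shows "(\<Pi>\<^sub>M i\<in>I. density M f) = density (\<Pi>\<^sub>M i\<in>I. M) (\<lambda>z. \<Prod>i\<in>I. f (z i))"
proof -
  interpret N: product_sigma_finite "\<lambda>i. M" using M by (simp add: product_sigma_finite_def)
  interpret D: product_sigma_finite "\<lambda>i. density M f" using M by (simp add: product_sigma_finite_def)
  have sets_eq: "sets (\<Pi>\<^sub>M i\<in>I. density M f) = sets (\<Pi>\<^sub>M i\<in>I. M)"
    by (intro sets_PiM_cong) auto
  show ?thesis
  proof (rule D.PiM_eqI[symmetric])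
    fix A assume "\<And>i. i \<in> I \<Longrightarrow> A i \<in> sets (density M f)"
    then have A[measurable]: "\<And>i. i \<in> I \<Longrightarrow> A i \<in> sets M" by simp
    have [measurable]: "Pi\<^sub>E I A \<in> sets (\<Pi>\<^sub>M i\<in>I. M)"
      using I by (intro sets_PiM_I_finite) auto
    have "emeasure (density (\<Pi>\<^sub>M i\<in>I. M) (\<lambda>z. \<Prod>i\<in>I. f (z i))) (Pi\<^sub>E I A)
       = (\<integral>\<^sup>+z. (\<Prod>i\<in>I. f (z i)) * indicator (Pi\<^sub>E I A) z \<partial>(\<Pi>\<^sub>M i\<in>I. M))"
      by (subst emeasure_density) (auto intro!: borel_measurable_prod_ennreal)
    also have "\<dots> = (\<integral>\<^sup>+z. (\<Prod>i\<in>I. f (z i) * indicator (A i) (z i)) \<partial>(\<Pi>\<^sub>M i\<in>I. M))"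
    proof (rule nn_integral_cong)
      fix z assume z: "z \<in> space (\<Pi>\<^sub>M i\<in>I. M)"
      have "indicator (Pi\<^sub>E I A) z = (\<Prod>i\<in>I. indicator (A i) (z i) :: ennreal)"
        using z I by (auto simp: indicator_def space_PiM PiE_iff)
      then show "(\<Prod>i\<in>I. f (z i)) * indicator (Pi\<^sub>E I A) z = (\<Prod>i\<in>I. f (z i) * indicator (A i) (z i))"
        by (simp add: prod.distrib)
    qed
    also have "\<dots> = (\<Prod>i\<in>I. \<integral>\<^sup>+x. f x * indicator (A i) x \<partial>M)"
      by (rule N.product_nn_integral_prod[OF I]) auto
    also have "\<dots> = (\<Prod>i\<in>I. emeasure (density M f) (A i))"
      by (intro prod.cong) (auto simp: emeasure_density)
    finally show "emeasure (density (\<Pi>\<^sub>M i\<in>I. M) (\<lambda>z. \<Prod>i\<in>I. f (z i))) (Pi\<^sub>E I A)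
       = (\<Prod>i\<in>I. emeasure (density M f) (A i))" .
  qed (use I sets_eq in auto)
qed

text \<open>The density depends on \<open>Z\<close> only through its Frobenius norm, which is the
  source of all orthogonal invariance below.\<close>

lemma std_normal_matrix_eq_density:
  "(std_normal_matrix :: (real^'p^'n) measure) =
     density lborel (\<lambda>Z. ennreal ((1 / sqrt (2 * pi)) ^ CARD('n \<times> 'p) * exp (- (norm Z)\<^sup>2 / 2)))"
proof -
  let ?mat = "\<lambda>z. (\<chi> i j. z (i, j)) :: real^'p^'n"
  have meas[measurable]: "?mat \<in> (\<Pi>\<^sub>M ij\<in>(UNIV :: ('n \<times> 'p) set). lborel) \<rightarrow>\<^sub>M borel"
  proof -
    have sets_eq: "sets (\<Pi>\<^sub>M ij\<in>(UNIV :: ('n \<times> 'p) set). density lborel (\<lambda>x. ennreal (std_normal_density x)))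
      = sets (\<Pi>\<^sub>M ij\<in>(UNIV :: ('n \<times> 'p) set). lborel)"
      by (intro sets_PiM_cong) auto
    show ?thesis
      by (subst measurable_cong_sets[OF sets_eq[symmetric] refl]) (rule measurable_matrix_of_entries)
  qed
  have dens: "(\<Prod>ij\<in>UNIV. std_normal_density (z ij))
      = (1 / sqrt (2 * pi)) ^ CARD('n \<times> 'p) * exp (- (norm (?mat z))\<^sup>2 / 2)" for z :: "'n \<times> 'p \<Rightarrow> real"
  proof -
    have "(norm (?mat z))\<^sup>2 = (\<Sum>i\<in>UNIV. \<Sum>j\<in>UNIV. (z (i, j))\<^sup>2)"
      by (simp add: power2_norm_eq_inner inner_vec_def) (simp add: power2_eq_square)
    also have "\<dots> = (\<Sum>ij\<in>UNIV. (z ij)\<^sup>2)"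
      by (simp add: sum.cartesian_product)
    finally show ?thesis
      by (simp add: std_normal_density_def prod.distrib exp_sum[symmetric] sum_negf
          sum_divide_distrib prod_dividef power_divide)
  qed
  have "std_normal_matrix = distr (density (\<Pi>\<^sub>M ij\<in>(UNIV :: ('n \<times> 'p) set). lborel)
        (\<lambda>z. \<Prod>ij\<in>UNIV. ennreal (std_normal_density (z ij)))) borel ?mat"
    unfolding std_normal_matrix_def
    by (subst PiM_density) (auto intro!: sigma_finite_lborel prob_space_imp_sigma_finite prob_space_normal_density)
  also have "\<dots> = density (distr (\<Pi>\<^sub>M ij\<in>(UNIV :: ('n \<times> 'p) set). lborel) borel ?mat)
      (\<lambda>Z. ennreal ((1 / sqrt (2 * pi)) ^ CARD('n \<times> 'p) * exp (- (norm Z)\<^sup>2 / 2)))"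
    by (subst density_distr) (auto simp: prod_ennreal dens)
  finally show ?thesis by (simp add: distr_PiM_lborel_matrix[symmetric])
qed

subsection \<open>The polar factor\<close>

lemma matrix_inv:
  fixes A :: "real^'n^'n"
  assumes "invertible A"
  shows "A ** matrix_inv A = mat 1" "matrix_inv A ** A = mat 1"
proof -
  have "\<exists>A'. A ** A' = mat 1 \<and> A' ** A = mat 1"
    using assms by (simp add: invertible_def)
  from someI_ex[OF this] show "A ** matrix_inv A = mat 1" "matrix_inv A ** A = mat 1"
    by (simp_all add: matrix_inv_def)
qed

text \<open>Cramer's rule exhibits the entries of the inverse as quotients of determinants, from
  which continuity is read off.\<close>

lemma matrix_inv_nth:
  fixes A :: "real^'n^'n"
  assumes "invertible A"
  shows "matrix_inv A $ k $ l =
    det (\<chi> i j. if j = k then axis l 1 $ i else A $ i $ j) / det A"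
proof -
  have "A *v (matrix_inv A *v axis l 1) = axis l 1"
    by (simp add: matrix_vector_mul_assoc matrix_inv[OF assms])
  then have "matrix_inv A *v axis l 1 =
      (\<chi> k. det (\<chi> i j. if j = k then axis l 1 $ i else A $ i $ j) / det A)"
    using cramer[of A "matrix_inv A *v axis l 1" "axis l 1"] assms by (simp add: invertible_det_nz)
  then show ?thesis
    by (simp add: vec_eq_iff matrix_vector_mult_basis column_def)
qed

lemma continuous_on_det_compose:
  fixes f :: "'a::topological_space \<Rightarrow> real^'n^'n"
  assumes "\<And>i j. continuous_on S (\<lambda>x. f x $ i $ j)"
  shows "continuous_on S (\<lambda>x. det (f x))"
  unfolding det_def by (intro continuous_intros assms)

lemma continuous_on_det: "continuous_on S (det :: real^'n^'n \<Rightarrow> real)"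
  by (rule continuous_on_det_compose) (intro continuous_intros)

lemma open_invertible: "open {A :: real^'n^'n. invertible A}"
  unfolding invertible_det_nz
  by (intro open_Collect_neq continuous_on_det continuous_on_const)

lemma continuous_on_matrix_inv:
  "continuous_on {A :: real^'n^'n. invertible A} matrix_inv"
proof -
  have entry: "continuous_on S (\<lambda>A :: real^'n^'n. if j = k then axis l 1 $ i else A $ i $ j)" for S i j k l
    by (cases "j = k") (auto intro!: continuous_intros)
  have "continuous_on {A :: real^'n^'n. invertible A} (\<lambda>A. \<chi> k l.
      det (\<chi> i j. if j = k then axis l 1 $ i else A $ i $ j) / det A)"
    by (intro continuous_on_vec_lambda continuous_on_divide continuous_on_det_compose ballI)
       (auto simp: invertible_det_nz entry intro!: continuous_intros)
  then show ?thesis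
    by (rule continuous_on_cong[THEN iffD1, rotated 2]) (auto simp: vec_eq_iff matrix_inv_nth)
qed

lemma continuous_on_matrix_matrix_mult [continuous_intros]:
  fixes f :: "'a::topological_space \<Rightarrow> real^'m^'n" and g :: "'a \<Rightarrow> real^'p^'m"
  assumes "continuous_on S f" "continuous_on S g"
  shows "continuous_on S (\<lambda>x. f x ** g x)"
  unfolding matrix_matrix_mult_def by (intro continuous_intros assms)

lemma continuous_on_transpose [continuous_intros]:
  fixes f :: "'a::topological_space \<Rightarrow> real^'m^'n"
  assumes "continuous_on S f"
  shows "continuous_on S (\<lambda>x. transpose (f x))"
  unfolding transpose_def by (intro continuous_intros assms)

lemma linear_matrix_mult_left: "linear (\<lambda>Z :: real^'p^'m. (A :: real^'m^'n) ** Z)"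
  by (rule linearI)
     (simp_all add: matrix_matrix_mult_def vec_eq_iff algebra_simps sum.distrib sum_distrib_left)

lemma inner_matrix_mult_adjoint:
  fixes X :: "real^'p^'n" and A :: "real^'m^'n" and Y :: "real^'p^'m"
  shows "X \<bullet> (A ** Y) = (transpose A ** X) \<bullet> Y"
proof -
  have "X \<bullet> (A ** Y) = (\<Sum>i\<in>UNIV. \<Sum>j\<in>UNIV. \<Sum>k\<in>UNIV. X $ i $ j * (A $ i $ k * Y $ k $ j))"
    by (simp add: inner_vec_def matrix_matrix_mult_def sum_distrib_left)
  also have "\<dots> = (\<Sum>i\<in>UNIV. \<Sum>k\<in>UNIV. \<Sum>j\<in>UNIV. X $ i $ j * (A $ i $ k * Y $ k $ j))"
    by (intro sum.cong refl sum.swap)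
  also have "\<dots> = (\<Sum>k\<in>UNIV. \<Sum>i\<in>UNIV. \<Sum>j\<in>UNIV. X $ i $ j * (A $ i $ k * Y $ k $ j))"
    by (rule sum.swap)
  also have "\<dots> = (\<Sum>k\<in>UNIV. \<Sum>j\<in>UNIV. \<Sum>i\<in>UNIV. X $ i $ j * (A $ i $ k * Y $ k $ j))"
    by (intro sum.cong refl sum.swap)
  also have "\<dots> = (transpose A ** X) \<bullet> Y"
    by (simp add: inner_vec_def matrix_matrix_mult_def transpose_def sum_distrib_left sum_distrib_right mult_ac)
  finally show ?thesis .
qed

lemma norm_orthonormal_matrix_mult:
  fixes Q :: "real^'m^'n" and Z :: "real^'p^'m"
  assumes "transpose Q ** Q = mat 1"
  shows "norm (Q ** Z) = norm Z"
  unfolding norm_eq by (simp add: inner_matrix_mult_adjoint matrix_mul_assoc assms)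

lemma norm_orthonormal_matrix_vector_mult:
  fixes Q :: "real^'m^'n"
  assumes "transpose Q ** Q = mat 1"
  shows "norm (Q *v x) = norm x"
  unfolding norm_eq
  by (simp add: inner_transpose_matrix_vector[symmetric] matrix_vector_mul_assoc assms
      del: transpose_matrix_vector)

text \<open>The isometric factor of the polar decomposition of a matrix of full column rank.\<close>

definition polar :: "real^'p^'n \<Rightarrow> real^'p^'n" where
  "polar Y = Y ** matrix_inv (sym_sqrt (transpose Y ** Y))"

lemma invertible_sym_sqrt_gram:
  fixes Y :: "real^'p^'n"
  assumes "inj ((*v) Y)"
  shows "invertible (sym_sqrt (transpose Y ** Y))"
  by (intro positive_definite_invertible sym_sqrt positive_definite_gram assms)

text \<open>A matrix of full column rank differs from its polar factor by an invertible right
  factor, which a \<open>G_L\<close>-invariant function does not notice.\<close>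

lemma polar_mult_sqrt:
  fixes Y :: "real^'p^'n"
  assumes "inj ((*v) Y)"
  shows "polar Y ** sym_sqrt (transpose Y ** Y) = Y"
  unfolding polar_def
  by (simp add: matrix_mul_assoc[symmetric] matrix_inv invertible_sym_sqrt_gram[OF assms])

lemma polar_orthonormal:
  fixes Y :: "real^'p^'n"
  assumes "inj ((*v) Y)"
  shows "transpose (polar Y) ** polar Y = mat 1"
proof -
  define S where "S = sym_sqrt (transpose Y ** Y)"
  define V where "V = matrix_inv S"
  have S: "transpose S = S" "S ** S = transpose Y ** Y"
    using sym_sqrt[OF positive_definite_gram[OF assms]] by (simp_all add: S_def positive_definite_def)
  have V: "S ** V = mat 1" "V ** S = mat 1"
    using matrix_inv[OF invertible_sym_sqrt_gram[OF assms]] by (simp_all add: S_def V_def)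
  have "transpose V ** S = mat 1"
    using arg_cong[OF V(1), of transpose] by (simp add: matrix_transpose_mul S)
  then have "transpose V ** (S ** S) ** V = mat 1"
    by (simp add: matrix_mul_assoc V)
  then show ?thesis
    unfolding polar_def S_def[symmetric] V_def[symmetric] S(2)
    by (simp add: matrix_transpose_mul matrix_mul_assoc)
qed

text \<open>The Gram matrix does not change under \<open>H\<close>. This equivariance transfers
  Gaussian invariance to the polar factor.\<close>

lemma polar_orthogonal_mult:
  fixes Y :: "real^'p^'n"
  assumes "orthogonal_matrix H"
  shows "polar (H ** Y) = H ** polar Y"
proof -
  have HH: "transpose H ** H = mat 1" using assms by (simp add: orthogonal_matrix_def)
  have "transpose (H ** Y) ** (H ** Y) = transpose Y ** (transpose H ** H) ** Y"
    by (simp add: matrix_transpose_mul matrix_mul_assoc)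
  then have "transpose (H ** Y) ** (H ** Y) = transpose Y ** Y"
    by (simp only: HH matrix_mul_rid)
  then show ?thesis
    by (simp only: polar_def matrix_mul_assoc)
qed

lemma sym_sqrt_mat_1: "sym_sqrt (mat 1 :: real^'n^'n) = mat 1"
  by (intro sym_sqrt_eqI positive_definite_mat_1) simp

lemma polar_orthogonal_matrix:
  fixes E :: "real^'n^'n"
  assumes "orthogonal_matrix E"
  shows "polar E = E"
proof -
  have "matrix_inv (mat 1 :: real^'n^'n) = mat 1"
    using matrix_inv(1)[of "mat 1 :: real^'n^'n"] by (simp add: invertible_def)
  then show ?thesis
    using assms by (simp add: polar_def orthogonal_matrix_def sym_sqrt_mat_1)
qed

lemma continuous_on_polar: "continuous_on {G :: real^'n^'n. invertible G} polar"
proof -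
  let ?gram = "\<lambda>G :: real^'n^'n. transpose G ** G"
  have "continuous_on {G. invertible G} (\<lambda>G. sym_sqrt (?gram G))"
    by (rule continuous_on_compose2[OF continuous_on_sym_sqrt])
       (auto intro!: continuous_intros positive_definite_gram inj_matrix_vector_mult)
  then have "continuous_on {G. invertible G} (\<lambda>G. matrix_inv (sym_sqrt (?gram G)))"
    by (rule continuous_on_compose2[OF continuous_on_matrix_inv])
       (auto intro!: invertible_sym_sqrt_gram inj_matrix_vector_mult)
  then show ?thesis
    unfolding polar_def by (intro continuous_intros)
qed

text \<open>With \<open>f\<close> an isometry from the orthogonal complement of the columns of \<open>P\<close> to that of the
  columns of \<open>Q\<close>, the matrix of \<open>x \<mapsto> Q P\<^sup>T x + f (x - P P\<^sup>T x)\<close> is orthogonal.\<close>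

lemma orthonormal_columns_transitive:
  fixes P Q :: "real^'p^'n"
  assumes P: "transpose P ** P = mat 1" and Q: "transpose Q ** Q = mat 1"
  obtains H where "orthogonal_matrix H" "H ** P = Q"
proof -
  have PP: "transpose P *v (P *v x) = x" for x
    by (simp add: matrix_vector_mul_assoc P del: transpose_matrix_vector)
  define N where "N = (\<lambda>R :: real^'p^'n. {y. transpose R *v y = 0})"
  have N_alt: "N R = {y \<in> UNIV. \<forall>x \<in> range ((*v) R). orthogonal x y}" for R :: "real^'p^'n"
  proof -
    have eq: "(transpose R *v y = 0) \<longleftrightarrow> (\<forall>x. orthogonal (R *v x) y)" for y
      unfolding orthogonal_def inner_transpose_matrix_vector[symmetric]
      using vector_eq_ldot[of "transpose R *v y" 0] by (simp del: transpose_matrix_vector)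
    show ?thesis unfolding N_def eq by blast
  qed
  have sub: "subspace (N R)" for R :: "real^'p^'n"
    unfolding N_def by (rule linear_subspace_kernel[OF matrix_vector_mul_linear])
  \<comment> \<open>The two complements have equal dimension, so a linear isometry \<open>f\<close>
    between them exists.\<close>
  have dimN: "dim (N R) + CARD('p) = CARD('n)" if "transpose R ** R = mat 1" for R :: "real^'p^'n"
  proof -
    have "inj ((*v) R)"
      by (rule inj_on_inverseI[where g = "(*v) (transpose R)"])
         (simp add: matrix_vector_mul_assoc that del: transpose_matrix_vector)
    then have "dim (range ((*v) R)) = CARD('p)"
      by (subst dim_image_eq) auto
    moreover have "subspace (range ((*v) R))"
      by (intro linear_subspace_image) auto
    ultimately show ?thesis
      using dim_subspace_orthogonal_to_vectors[of "range ((*v) R)" UNIV]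
      unfolding N_alt by simp
  qed
  have "dim (N P) = dim (N Q)" using dimN[OF P] dimN[OF Q] by simp
  then obtain f where f: "linear f" "f ` N P = N Q" "\<And>x. x \<in> N P \<Longrightarrow> norm (f x) = norm x"
    using isometries_subspaces[OF sub sub] by metis
  \<comment> \<open>Orthogonal projection onto \<open>N P\<close>;
    \<open>P *v (transpose P *v x)\<close> is the complementary part of \<open>x\<close>.\<close>
  define r where "r = (\<lambda>x. x - P *v (transpose P *v x))"
  have r: "r x \<in> N P" for x
    unfolding N_def r_def by (simp add: matrix_vector_mult_diff_distrib PP del: transpose_matrix_vector)
  \<comment> \<open>Used twice: with \<open>Q\<close> for the image \<open>h x\<close> and with
    \<open>P\<close> for the decomposition of \<open>x\<close>.\<close>
  have pyth: "(norm (R *v x + y))\<^sup>2 = (norm x)\<^sup>2 + (norm y)\<^sup>2"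
    if "transpose R ** R = mat 1" "y \<in> N R" for R :: "real^'p^'n" and x y
  proof -
    have "orthogonal (R *v x) y" using that(2) N_alt by blast
    from norm_add_Pythagorean[OF this] show ?thesis
      by (simp add: norm_orthonormal_matrix_vector_mult[OF that(1)])
  qed
  define h where "h = (\<lambda>x. Q *v (transpose P *v x) + f (r x))"
  have lin_r: "linear r"
    unfolding r_def
    by (rule linear_compose_sub[OF linear_ident linear_compose[unfolded o_def,
          OF matrix_vector_mul_linear matrix_vector_mul_linear]])
  have lin: "linear h"
    unfolding h_def
    by (rule linear_compose_add[OF linear_compose[unfolded o_def,
          OF matrix_vector_mul_linear matrix_vector_mul_linear]
          linear_compose[OF lin_r f(1), unfolded o_def]])
  have "norm (h x) = norm x" for x
  proof -
    have "(norm (h x))\<^sup>2 = (norm (transpose P *v x))\<^sup>2 + (norm (r x))\<^sup>2"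
      unfolding h_def using r[of x] f(2) by (subst pyth[OF Q]) (auto simp: f(3))
    also have "\<dots> = (norm (P *v (transpose P *v x) + r x))\<^sup>2"
      by (rule pyth[OF P r, symmetric])
    also have "\<dots> = (norm x)\<^sup>2" by (simp add: r_def)
    finally show ?thesis by simp
  qed
  then have "orthogonal_matrix (matrix h)"
    using lin orthogonal_transformation orthogonal_transformation_matrix by blast
  moreover have "matrix h ** P = Q"
  proof -
    have hv: "matrix h *v x = h x" for x by (simp add: matrix_works lin)
    have "r (P *v x) = 0" for x by (simp add: r_def PP del: transpose_matrix_vector)
    then have "(matrix h ** P) *v x = Q *v x" for x
      by (simp add: matrix_vector_mul_assoc[symmetric] hv, simp add: h_def PP linear_0[OF f(1)]
          del: transpose_matrix_vector)
    then show ?thesis by (simp add: matrix_eq)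
  qed
  ultimately show ?thesis by (rule that)
qed

subsection \<open>Linear images of the standard normal law\<close>

lemma sets_std_normal_matrix [simp, measurable_cong]: "sets std_normal_matrix = sets borel"
  and space_std_normal_matrix [simp]: "space std_normal_matrix = UNIV"
  by (simp_all add: std_normal_matrix_def)

lemma prob_density_const_eq:
  assumes "prob_space M" "prob_space (density M (\<lambda>_. c))"
  shows "c = 1"
proof -
  have "emeasure (density M (\<lambda>_. c)) (space M) = c * emeasure M (space M)"
    by (simp add: emeasure_density_const)
  then show ?thesis
    using prob_space.emeasure_space_1[OF assms(1)] prob_space.emeasure_space_1[OF assms(2)] by simp
qed

text \<open>The density is taken relative to the Gaussian law itself, so it is a quotient of two
  Gaussian densities; \<open>c\<close> absorbs the Jacobian.\<close>

lemma std_normal_matrix_distr_linear: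
  fixes T T' :: "real^'p^'n \<Rightarrow> real^'p^'n"
  assumes lin: "linear T" "linear T'" and inv: "\<And>x. T (T' x) = x" "\<And>x. T' (T x) = x"
  shows "\<exists>c\<ge>0. distr std_normal_matrix borel T =
    density std_normal_matrix (\<lambda>Y. ennreal (c * exp ((norm Y)\<^sup>2 / 2 - (norm (T' Y))\<^sup>2 / 2)))"
proof -
  have T[measurable]: "T \<in> borel_measurable borel" "T' \<in> borel_measurable borel"
    using lin by (auto intro: borel_measurable_linear)
  define K where "K = (1 / sqrt (2 * pi)) ^ CARD('n \<times> 'p)"
  have K: "K > 0" by (simp add: K_def)
  define g where "g = (\<lambda>Z :: real^'p^'n. K * exp (- (norm Z)\<^sup>2 / 2))"
  have g_meas[measurable]: "g \<in> borel_measurable borel" unfolding g_def by measurable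
  have g_pos: "g Z > 0" for Z using K by (simp add: g_def)
  have std: "std_normal_matrix = density lborel (\<lambda>Z. ennreal (g Z))"
    by (simp add: std_normal_matrix_eq_density g_def K_def)
  obtain C where C: "distr lborel borel T = density lborel (\<lambda>_. C)"
    using lborel_distr_linear_isomorphism[OF lin inv] by blast
  have "distr std_normal_matrix borel T = density (distr lborel borel T) (\<lambda>Y. ennreal (g (T' Y)))"
    unfolding std by (subst density_distr) (simp_all add: inv)
  then have eq: "distr std_normal_matrix borel T = density lborel (\<lambda>Y. C * ennreal (g (T' Y)))"
    unfolding C by (subst (asm) density_density_eq) auto
  \<comment> \<open>An infinite factor would give the image of a probability measure infinite
    mass.\<close>
  have "C \<noteq> \<top>"
  proof
    assume "C = \<top>"
    then have "C * ennreal (g (T' Y)) = \<top>" for Y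
      using g_pos[of "T' Y"] by (simp add: ennreal_top_mult ennreal_eq_0_iff)
    then have "emeasure (distr std_normal_matrix borel T) UNIV = \<top>"
      unfolding eq by (simp add: emeasure_density_const ennreal_mult_top emeasure_lborel_UNIV)
    moreover have "prob_space (distr std_normal_matrix borel T)"
      by (intro prob_space.prob_space_distr prob_space_std_normal_matrix) simp
    ultimately show False using prob_space.emeasure_space_1 by fastforce
  qed
  then obtain c where c: "C = ennreal c" "c \<ge> 0" by (cases C) auto
  have "C * ennreal (g (T' Y)) = ennreal (g Y) * ennreal (c * exp ((norm Y)\<^sup>2 / 2 - (norm (T' Y))\<^sup>2 / 2))" for Y
  proof -
    have "c * g (T' Y) = g Y * (c * exp ((norm Y)\<^sup>2 / 2 - (norm (T' Y))\<^sup>2 / 2))"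
      unfolding g_def by (simp add: mult_ac flip: exp_add)
    then show ?thesis unfolding c(1)
      using c(2) g_pos by (metis ennreal_mult' less_imp_le)
  qed
  then have "distr std_normal_matrix borel T = density std_normal_matrix
      (\<lambda>Y. ennreal (c * exp ((norm Y)\<^sup>2 / 2 - (norm (T' Y))\<^sup>2 / 2)))"
    by (subst eq, subst std, subst density_density_eq) auto
  then show ?thesis using c(2) by blast
qed

text \<open>The inverse preserves the norm too, so the relative density is constant, and total mass
  1 makes it 1.\<close>

lemma std_normal_matrix_distr_isometry:
  fixes T T' :: "real^'p^'n \<Rightarrow> real^'p^'n"
  assumes lin: "linear T" "linear T'" and inv: "\<And>x. T (T' x) = x" "\<And>x. T' (T x) = x"
    and norm: "\<And>x. norm (T x) = norm x"
  shows "distr std_normal_matrix borel T = std_normal_matrix"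
proof -
  have [measurable]: "T \<in> borel_measurable borel"
    using lin by (auto intro: borel_measurable_linear)
  have "norm (T' Y) = norm Y" for Y by (metis norm inv(1))
  then obtain c where c: "distr std_normal_matrix borel T = density std_normal_matrix (\<lambda>_. ennreal c)"
    using std_normal_matrix_distr_linear[OF lin inv] by auto
  moreover have "prob_space (distr std_normal_matrix borel T)"
    by (intro prob_space.prob_space_distr prob_space_std_normal_matrix) simp
  ultimately have "ennreal c = 1"
    using prob_density_const_eq prob_space_std_normal_matrix by metis
  then show ?thesis by (simp add: c density_1)
qed

lemma std_normal_matrix_distr_orthogonal:
  fixes H :: "real^'n^'n"
  assumes "orthogonal_matrix H"
  shows "distr std_normal_matrix borel (\<lambda>Z :: real^'p^'n. H ** Z) = std_normal_matrix"
  using assms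
  by (intro std_normal_matrix_distr_isometry[where T' = "\<lambda>Z. transpose H ** Z"] linear_matrix_mult_left)
     (simp_all add: matrix_mul_assoc orthogonal_matrix_def norm_orthonormal_matrix_mult)

lemma borel_measurable_matrix_mult_left [measurable]:
  "(\<lambda>Z :: real^'p^'m. (A :: real^'m^'n) ** Z) \<in> borel_measurable borel"
  by (intro borel_measurable_linear linear_matrix_mult_left)

lemma integral_std_normal_matrix_orthogonal:
  fixes H :: "real^'n^'n" and F :: "real^'p^'n \<Rightarrow> real"
  assumes "orthogonal_matrix H" and [measurable]: "F \<in> borel_measurable borel"
  shows "(\<integral>Z. F (H ** Z) \<partial>std_normal_matrix) = (\<integral>Z. F Z \<partial>std_normal_matrix)"
  by (subst (2) std_normal_matrix_distr_orthogonal[OF assms(1), symmetric], subst integral_distr) auto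

section \<open>Null sets and almost sure full rank\<close>

lemma AE_std_normal_matrix_iff:
  "(AE Z :: real^'p^'n in std_normal_matrix. P Z) \<longleftrightarrow> (AE Z in lborel. P Z)"
  unfolding std_normal_matrix_eq_density by (subst AE_density) auto

text \<open>The part of \<open>S\<close> where \<open>f\<close> differs from \<open>c\<close> is
  open and null, hence empty.\<close>

lemma AE_lborel_continuous_eq:
  fixes f :: "'a::euclidean_space \<Rightarrow> real"
  assumes ae: "AE x in lborel. x \<in> S \<longrightarrow> f x = c"
    and S: "open S" and f: "continuous_on S f" and x: "x \<in> S"
  shows "f x = c"
proof (rule ccontr)
  assume "f x \<noteq> c"
  define U where "U = S \<inter> f -` (- {c})"
  have U: "open U" unfolding U_def
    using f S by (intro continuous_open_preimage) auto
  have "AE x in lborel. x \<notin> U" using ae by eventually_elim (auto simp: U_def)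
  then have "U \<in> null_sets lborel"
    using U by (subst (asm) AE_iff_null_sets[symmetric]) auto
  then have "negligible U"
    by (simp add: negligible_iff_null_sets null_sets_completionI)
  moreover have "U \<noteq> {}" using x \<open>f x \<noteq> c\<close> by (auto simp: U_def)
  ultimately show False using open_not_negligible[OF U] by blast
qed

text \<open>The determinant is a polynomial in \<open>t\<close>, and not the zero polynomial: once
  \<open>t\<close> exceeds a bound for the operator norm of \<open>B\<close>, the shifted matrix has
  trivial kernel.\<close>

lemma finite_singular_shifts:
  fixes B :: "real^'n^'n"
  shows "finite {t. det (B + t *\<^sub>R mat 1) = 0}"
proof -
  have entry: "real_polynomial_function (\<lambda>t. (B + t *\<^sub>R mat 1) $ i $ j)" for i j
  proof -
    have "real_polynomial_function (\<lambda>t. B $ i $ j + t * mat 1 $ i $ j)"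
      by (rule real_polynomial_function.intros(3)[OF real_polynomial_function.intros(2)
            real_polynomial_function.intros(1)[OF bounded_linear_mult_left]])
    then show ?thesis by simp
  qed
  have "real_polynomial_function (\<lambda>t. det (B + t *\<^sub>R mat 1))"
    unfolding det_def
    by (intro real_polynomial_function_sum real_polynomial_function.intros(2,4) real_polynomial_function_prod entry)
       (simp_all add: finite_permutations)
  then obtain a n where an: "(\<lambda>t. det (B + t *\<^sub>R mat 1)) = (\<lambda>t. \<Sum>i\<le>n. a i * t ^ i)"
    by (auto simp: real_polynomial_function_iff_sum)
  obtain b where b: "b > 0" "\<And>x. norm (B *v x) \<le> norm x * b"
    using bounded_linear.pos_bounded[OF matrix_vector_mul_bounded_linear[of B]] by blast
  have "invertible (B + (b + 1) *\<^sub>R mat 1)"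
    unfolding invertible_left_inverse matrix_left_invertible_ker
  proof (intro allI impI)
    fix x assume "(B + (b + 1) *\<^sub>R mat 1) *v x = 0"
    then have "B *v x + (b + 1) *\<^sub>R x = 0"
      by (simp add: matrix_vector_mult_add_rdistrib scaleR_matrix_vector_assoc[symmetric])
    then have "B *v x = - ((b + 1) *\<^sub>R x)" by (simp add: eq_neg_iff_add_eq_0)
    then have "(b + 1) * norm x \<le> norm x * b" using b(2)[of x] b(1) by simp
    then have "norm x \<le> 0" by (simp add: algebra_simps)
    then show "x = 0" by simp
  qed
  then have "det (B + (b + 1) *\<^sub>R mat 1) \<noteq> 0" by (simp add: invertible_det_nz)
  then have "(\<Sum>i\<le>n. a i * (b + 1) ^ i) \<noteq> 0" by (metis an)
  then have "\<exists>i\<le>n. a i \<noteq> 0" by (metis (no_types, lifting) atMost_iff mult_zero_left sum.neutral)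
  then have "finite {t. (\<Sum>i\<le>n. a i * t ^ i) = 0}" by (subst polyfun_finite_roots)
  moreover have "det (B + t *\<^sub>R mat 1) = (\<Sum>i\<le>n. a i * t ^ i)" for t using an by meson
  ultimately show ?thesis by simp
qed

text \<open>By translation invariance, the measure of the exceptional set is, up to a factor,
  the integral over \<open>Z\<close> of the length of the finite set of \<open>t\<close> for which \<open>Z + t J\<close> is exceptional.\<close>

lemma AE_full_column_rank:
  assumes card: "CARD('p) \<le> CARD('n)"
  shows "AE Z :: real^'p^'n in std_normal_matrix. inj ((*v) Z)"
proof -
  obtain s :: "'p \<Rightarrow> 'n" where s: "inj s"
    using card_le_inj[of "UNIV :: 'p set" "UNIV :: 'n set"] card by auto
  \<comment> \<open>The columns of \<open>J\<close> are distinct unit vectors, so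
    \<open>transpose J ** Z\<close> selects a square block of \<open>Z\<close>, and moving
    \<open>Z\<close> along \<open>J\<close> shifts this block by a multiple of the identity.\<close>
  define J :: "real^'p^'n" where "J = (\<chi> i j. if i = s j then 1 else 0)"
  have "(transpose J ** J) $ i $ j = (mat 1 :: real^'p^'p) $ i $ j" for i j
  proof -
    have "(transpose J ** J) $ i $ j = (\<Sum>k\<in>UNIV. if k = s i then if k = s j then 1 else 0 else 0)"
      unfolding J_def transpose_def matrix_matrix_mult_def vec_lambda_beta
      by (intro sum.cong) auto
    also have "\<dots> = (if i = j then 1 else 0)" by (simp add: inj_eq[OF s])
    finally show ?thesis by (simp only: mat_def vec_lambda_beta)
  qed
  then have JJ: "transpose J ** J = mat 1" by (simp only: vec_eq_iff simp_thms)
  define N where "N = {Z :: real^'p^'n. det (transpose J ** Z) = 0}"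
  have "closed N" unfolding N_def
    by (intro closed_Collect_eq continuous_on_const continuous_on_compose2[OF continuous_on_det[of UNIV]]
        continuous_intros) auto
  then have [measurable]: "N \<in> sets borel" by simp
  have "(\<integral>\<^sup>+Z. indicator N (Z + t *\<^sub>R J) \<partial>lborel) = emeasure lborel N" for t
  proof -
    have "(\<integral>\<^sup>+Z. indicator N (t *\<^sub>R J + Z) \<partial>lborel)
        = (\<integral>\<^sup>+Z. indicator N Z \<partial>distr lborel borel ((+) (t *\<^sub>R J)))"
      by (subst nn_integral_distr) auto
    then show ?thesis by (simp add: lborel_distr_plus add.commute)
  qed
  \<comment> \<open>The inner integral does not depend on \<open>t\<close>, so the outer one
    multiplies by the infinite length of the line; the value 0 obtained after the exchange forces
    measure 0.\<close>
  then have "emeasure lborel N * \<top> = (\<integral>\<^sup>+t. (\<integral>\<^sup>+Z. indicator N (Z + t *\<^sub>R J) \<partial>lborel) \<partial>(lborel :: real measure))"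
    by (simp add: emeasure_lborel_UNIV)
  also have "\<dots> = (\<integral>\<^sup>+Z. (\<integral>\<^sup>+t. indicator N (Z + t *\<^sub>R J) \<partial>(lborel :: real measure)) \<partial>lborel)"
    by (rule lborel_pair.Fubini') measurable
  also have "\<dots> = (\<integral>\<^sup>+(Z :: real^'p^'n). 0 \<partial>lborel)"
  proof (rule nn_integral_cong)
    fix Z
    have "transpose J ** (Z + t *\<^sub>R J) = transpose J ** Z + t *\<^sub>R mat 1" for t
      by (simp add: linear_add[OF linear_matrix_mult_left] linear_scale[OF linear_matrix_mult_left] JJ)
    then have "{t. Z + t *\<^sub>R J \<in> N} = {t. det (transpose J ** Z + t *\<^sub>R mat 1) = 0}"
      by (simp add: N_def)
    then have fin: "finite {t. Z + t *\<^sub>R J \<in> N}" by (simp add: finite_singular_shifts)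
    have "(\<integral>\<^sup>+t. indicator N (Z + t *\<^sub>R J) \<partial>lborel) = (\<integral>\<^sup>+t. indicator {t. Z + t *\<^sub>R J \<in> N} t \<partial>lborel)"
      by (intro nn_integral_cong) (simp add: indicator_def)
    also have "\<dots> = emeasure lborel {t. Z + t *\<^sub>R J \<in> N}"
      using fin by (intro nn_integral_indicator) (simp add: finite_imp_closed)
    also have "\<dots> = 0" using fin by (intro emeasure_lborel_countable countable_finite)
    finally show "(\<integral>\<^sup>+t. indicator N (Z + t *\<^sub>R J) \<partial>lborel) = 0" .
  qed
  finally have "emeasure lborel N = 0" by (simp add: ennreal_mult_eq_top_iff)
  then have "AE Z in lborel. Z \<notin> N"
    by (intro AE_not_in) (simp add: null_sets_def)
  then have "AE Z :: real^'p^'n in lborel. inj ((*v) Z)"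
  proof eventually_elim
    case (elim Z)
    then have "invertible (transpose J ** Z)" by (simp add: N_def invertible_det_nz)
    then have "inj (\<lambda>x. transpose J *v (Z *v x))"
      using inj_matrix_vector_mult by (simp add: matrix_vector_mul_assoc del: transpose_matrix_vector)
    then show ?case by (auto simp: inj_on_def)
  qed
  then show ?thesis by (simp add: AE_std_normal_matrix_iff)
qed

subsection \<open>Averaging over the orthogonal group\<close>

text \<open>By scale invariance \<open>D\<close> may be assumed to be a contraction; then the law of \<open>E D Z\<close> has a bounded
  density with respect to that of \<open>Z\<close>, and dominated convergence applies.\<close>

lemma continuous_on_rotated_expectation:
  fixes \<phi> :: "real^'p^'n \<Rightarrow> real" and D :: "real^'n^'n"
  assumes [measurable]: "\<phi> \<in> borel_measurable borel" and range: "\<And>Y. \<phi> Y \<in> {0..1}"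
    and scale: "\<And>s Y. s \<noteq> 0 \<Longrightarrow> \<phi> (s *\<^sub>R Y) = \<phi> Y" and D: "invertible D"
  shows "continuous_on {E. orthogonal_matrix E} (\<lambda>E. \<integral>Z. \<phi> (E ** D ** Z) \<partial>std_normal_matrix)"
proof -
  interpret prob_space "std_normal_matrix :: (real^'p^'n) measure"
    by (rule prob_space_std_normal_matrix)
  have lin: "linear (\<lambda>Z :: real^'p^'n. A ** Z)" for A :: "real^'n^'n"
    by (rule linear_matrix_mult_left)
  have mult_scale: "A ** (s *\<^sub>R Z) = s *\<^sub>R (A ** Z)" for A :: "real^'n^'n" and s and Z :: "real^'p^'n"
    by (rule linear_scale[OF lin])
  obtain b where b: "b > 0" "\<And>Z :: real^'p^'n. norm (D ** Z) \<le> norm Z * b"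
    using bounded_linear.pos_bounded lin linear_conv_bounded_linear by blast
  define T T' where "T = (\<lambda>Z :: real^'p^'n. (1 / b) *\<^sub>R (D ** Z))"
    and "T' = (\<lambda>Y :: real^'p^'n. b *\<^sub>R (matrix_inv D ** Y))"
  have linT: "linear T" "linear T'"
    unfolding T_def T'_def by (intro linear_compose_scale_right lin)+
  then have [measurable]: "T \<in> borel_measurable borel" "T' \<in> borel_measurable borel"
    by (auto intro: borel_measurable_linear)
  have inv: "T (T' x) = x" "T' (T x) = x" for x
    using b(1) by (simp_all add: T_def T'_def mult_scale matrix_mul_assoc matrix_inv[OF D])
  have normT: "norm (T x) \<le> norm x" for x
    using b by (simp add: T_def field_simps)
  obtain c where c: "c \<ge> 0" "distr std_normal_matrix borel T =
    density std_normal_matrix (\<lambda>Y. ennreal (c * exp ((norm Y)\<^sup>2 / 2 - (norm (T' Y))\<^sup>2 / 2)))"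
    using std_normal_matrix_distr_linear[OF linT inv] by blast
  define \<rho> where "\<rho> = (\<lambda>Y. c * exp ((norm Y)\<^sup>2 / 2 - (norm (T' Y))\<^sup>2 / 2))"
  have distrT: "distr std_normal_matrix borel T = density std_normal_matrix (\<lambda>Y. ennreal (\<rho> Y))"
    using c(2) by (simp add: \<rho>_def)
  have \<rho>_meas[measurable]: "\<rho> \<in> borel_measurable borel" unfolding \<rho>_def by measurable
  have \<rho>: "0 \<le> \<rho> Y" "\<rho> Y \<le> c" for Y
  proof -
    \<comment> \<open>The inverse of a contraction expands, so the exponent in \<open>\<rho>\<close>
      is nonpositive and \<open>c\<close> is the dominating constant.\<close>
    have "norm Y \<le> norm (T' Y)" using normT[of "T' Y"] by (simp add: inv)
    then have "(norm Y)\<^sup>2 \<le> (norm (T' Y))\<^sup>2" by (simp add: power_mono)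
    then have "exp ((norm Y)\<^sup>2 / 2 - (norm (T' Y))\<^sup>2 / 2) \<le> 1" by simp
    then show "0 \<le> \<rho> Y" "\<rho> Y \<le> c" using c(1) by (auto simp: \<rho>_def intro: mult_left_le)
  qed
  have \<rho>_cont: "continuous_on UNIV \<rho>"
    unfolding \<rho>_def
    by (intro continuous_intros linear_continuous_on linT(2)[unfolded linear_conv_bounded_linear]) auto
  \<comment> \<open>The substitution of \<open>transpose E ** Y\<close> for \<open>Y\<close> leaves
    \<open>E\<close> only in the continuous factor \<open>\<rho>\<close>.\<close>
  have eq: "(\<integral>Z. \<phi> (E ** D ** Z) \<partial>std_normal_matrix)
      = (\<integral>Y. \<rho> (transpose E ** Y) * \<phi> Y \<partial>std_normal_matrix)" if E: "orthogonal_matrix E" for E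
  proof -
    have "\<phi> (E ** D ** Z) = \<phi> (E ** T Z)" for Z
      using b(1) scale[of "1 / b" "E ** D ** Z"] by (simp add: T_def mult_scale matrix_mul_assoc)
    then have "(\<integral>Z. \<phi> (E ** D ** Z) \<partial>std_normal_matrix) = (\<integral>Y. \<phi> (E ** Y) \<partial>distr std_normal_matrix borel T)"
      by (simp add: integral_distr)
    also have "\<dots> = (\<integral>Y. \<rho> Y * \<phi> (E ** Y) \<partial>std_normal_matrix)"
      unfolding distrT using \<rho>(1) by (subst integral_density) auto
    also have "\<dots> = (\<integral>Y. \<rho> (transpose E ** (E ** Y)) * \<phi> (E ** Y) \<partial>std_normal_matrix)"
      using E by (simp add: matrix_mul_assoc orthogonal_matrix_def)
    also have "\<dots> = (\<integral>Y. \<rho> (transpose E ** Y) * \<phi> Y \<partial>std_normal_matrix)"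
      by (rule integral_std_normal_matrix_orthogonal[OF E]) measurable
    finally show ?thesis .
  qed
  have "continuous_on {E. orthogonal_matrix E} (\<lambda>E. \<integral>Y. \<rho> (transpose E ** Y) * \<phi> Y \<partial>std_normal_matrix)"
    unfolding continuous_on_sequentially
  proof (intro ballI allI impI, elim conjE)
    fix X :: "nat \<Rightarrow> real^'n^'n" and E assume X: "X \<longlonglongrightarrow> E"
    show "((\<lambda>E. \<integral>Y. \<rho> (transpose E ** Y) * \<phi> Y \<partial>std_normal_matrix) \<circ> X)
        \<longlonglongrightarrow> (\<integral>Y. \<rho> (transpose E ** Y) * \<phi> Y \<partial>std_normal_matrix)"
      unfolding comp_def
    proof (rule integral_dominated_convergence[where w = "\<lambda>_. c"])
      show "AE Y in std_normal_matrix. (\<lambda>i. \<rho> (transpose (X i) ** Y) * \<phi> Y)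
          \<longlonglongrightarrow> \<rho> (transpose E ** Y) * \<phi> Y"
      proof (intro AE_I2 tendsto_mult tendsto_const)
        fix Y :: "real^'p^'n"
        have "continuous_on UNIV (\<lambda>E. \<rho> (transpose E ** Y))"
          by (intro continuous_on_compose2[OF \<rho>_cont] continuous_intros) auto
        from continuous_on_tendsto_compose[OF this X]
        show "(\<lambda>i. \<rho> (transpose (X i) ** Y)) \<longlonglongrightarrow> \<rho> (transpose E ** Y)" by simp
      qed
      show "AE Y in std_normal_matrix. norm (\<rho> (transpose (X i) ** Y) * \<phi> Y) \<le> c" for i
      proof (intro AE_I2)
        fix Y :: "real^'p^'n"
        have "\<rho> (transpose (X i) ** Y) * \<phi> Y \<le> c * 1"
          using \<rho> range[of Y] c(1) by (intro mult_mono) auto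
        then show "norm (\<rho> (transpose (X i) ** Y) * \<phi> Y) \<le> c"
          using \<rho>(1) range[of Y] by simp
      qed
    qed auto
  qed
  then show ?thesis
    by (rule continuous_on_cong[THEN iffD2, rotated 2]) (auto simp: eq)
qed

section \<open>Reduction of the normal expectation by invariance\<close>

lemma sym_sqrt_orthogonal_conjugate:
  fixes E L :: "real^'n^'n"
  assumes E: "orthogonal_matrix E" and L: "positive_definite L"
  shows "sym_sqrt (E ** L ** transpose E) = E ** sym_sqrt L ** transpose E"
proof (rule sym_sqrt_eqI)
  let ?D = "sym_sqrt L"
  have D: "transpose ?D = ?D" "\<And>x. x \<noteq> 0 \<Longrightarrow> x \<bullet> (?D *v x) > 0" "?D ** ?D = L"
    using sym_sqrt[OF L] by (auto simp: positive_definite_def)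
  have EE: "transpose E ** E = mat 1" "E ** transpose E = mat 1"
    using E by (auto simp: orthogonal_matrix_def)
  show "positive_definite (E ** ?D ** transpose E)"
    unfolding positive_definite_def
  proof (intro conjI allI impI)
    show "transpose (E ** ?D ** transpose E) = E ** ?D ** transpose E"
      by (simp add: matrix_transpose_mul D matrix_mul_assoc)
    fix x :: "real^'n" assume "x \<noteq> 0"
    define y where "y = transpose E *v x"
    have x: "x = E *v y" by (simp add: y_def matrix_vector_mul_assoc EE del: transpose_matrix_vector)
    then have "y \<noteq> 0" using \<open>x \<noteq> 0\<close> by auto
    have "x \<bullet> ((E ** ?D ** transpose E) *v x) = x \<bullet> (E *v (?D *v y))"
      by (simp add: y_def matrix_vector_mul_assoc[symmetric] del: transpose_matrix_vector)
    also have "\<dots> = y \<bullet> (?D *v y)"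
      unfolding y_def by (metis inner_commute inner_transpose_matrix_vector)
    finally show "x \<bullet> ((E ** ?D ** transpose E) *v x) > 0"
      using D(2)[OF \<open>y \<noteq> 0\<close>] by simp
  qed
  have "(E ** ?D ** transpose E) ** (E ** ?D ** transpose E) = E ** ?D ** (transpose E ** E) ** ?D ** transpose E"
    by (simp only: matrix_mul_assoc)
  also have "\<dots> = E ** (?D ** ?D) ** transpose E"
    by (simp only: EE matrix_mul_rid matrix_mul_assoc)
  finally show "(E ** ?D ** transpose E) ** (E ** ?D ** transpose E) = E ** L ** transpose E"
    by (simp only: D(3))
qed

lemma invariant_under_G_L:
  fixes \<phi> :: "real^'p^'n \<Rightarrow> real"
  assumes "invariant_under G_L \<phi>" "invertible A"
  shows "\<phi> (Y ** A) = \<phi> Y"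
proof -
  have "invertible (transpose A)" using assms(2) by (simp add: invertible_det_nz)
  then have "(\<lambda>Y :: real^'p^'n. Y ** transpose (transpose A)) \<in> G_L"
    unfolding G_L_def by blast
  then show ?thesis using assms(1) by (auto simp: invariant_under_def)
qed

text \<open>The right factor \<open>sym_sqrt \<Sigma>\<close> is invertible and is absorbed by
  invariance; this makes expectations at \<open>\<Sigma>\<close> and at the identity
  comparable.\<close>

lemma normal_expectation_G_L_invariant:
  fixes \<phi> :: "real^'p^'n \<Rightarrow> real"
  assumes "invariant_under G_L \<phi>" and [measurable]: "\<phi> \<in> borel_measurable borel"
    and "positive_definite \<Sigma>"
  shows "normal_expectation \<phi> \<Sigma> \<Psi> = (\<integral>Z. \<phi> (sym_sqrt \<Psi> ** Z) \<partial>std_normal_matrix)"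
proof -
  have "invertible (sym_sqrt \<Sigma>)"
    by (intro positive_definite_invertible sym_sqrt assms)
  then show ?thesis
    unfolding normal_expectation_def matrix_normal_def
    by (subst integral_distr) (simp_all add: measurable_two_sided_mult invariant_under_G_L[OF assms(1)]
        measurable_cong_sets[OF sets_std_normal_matrix refl])
qed

text \<open>Haar distributed when \<open>G\<close> is Gaussian. The transpose turns \<open>G \<mapsto> H G\<close> into a right
  translation, so that only invariance of the Gaussian law under left multiplication is needed.\<close>

definition random_rotation :: "real^'n^'n \<Rightarrow> real^'n^'n" where
  "random_rotation G = (if invertible G then transpose (polar G) else mat 1)"

text \<open>The default \<open>mat 1\<close> on singular matrices makes this hold for every
  \<open>G\<close>, so the lower bound on \<open>f\<close> applies pointwise.\<close>

lemma orthogonal_random_rotation: "orthogonal_matrix (random_rotation G)"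
proof (cases "invertible G")
  case True
  then have "orthogonal_matrix (polar G)"
    by (simp add: orthogonal_matrix polar_orthonormal inj_matrix_vector_mult)
  then show ?thesis using True by (simp add: random_rotation_def)
qed (simp add: random_rotation_def orthogonal_matrix_id)

lemma borel_measurable_random_rotation [measurable]: "random_rotation \<in> borel_measurable borel"
proof -
  have "(\<lambda>G :: real^'n^'n. if G \<in> {G. invertible G} then transpose (polar G) else mat 1) \<in> borel_measurable borel"
    by (intro borel_measurable_continuous_on_if borel_open open_invertible continuous_intros continuous_on_polar)
  then show ?thesis by (simp add: random_rotation_def[abs_def])
qed

lemma random_rotation_orthogonal_mult:
  assumes "orthogonal_matrix H" "invertible G"
  shows "random_rotation (H ** G) = random_rotation G ** transpose H"
proof -
  have "invertible H" using assms(1) by (auto simp: invertible_def orthogonal_matrix_def)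
  then have "invertible (H ** G)" using assms(2) by (rule invertible_mult)
  then show ?thesis using assms
    by (simp add: random_rotation_def polar_orthogonal_mult matrix_transpose_mul)
qed

lemma AE_invertible: "AE G :: real^'n^'n in std_normal_matrix. invertible G"
proof -
  have "AE G :: real^'n^'n in std_normal_matrix. inj ((*v) G)"
    by (rule AE_full_column_rank) simp
  then show ?thesis
    by eventually_elim (simp add: invertible_left_inverse matrix_left_invertible_injective)
qed

lemma borel_measurable_matrix_matrix_mult [measurable (raw)]:
  fixes f :: "'a \<Rightarrow> real^'m^'n" and g :: "'a \<Rightarrow> real^'p^'m"
  assumes "f \<in> borel_measurable M" "g \<in> borel_measurable M"
  shows "(\<lambda>x. f x ** g x) \<in> borel_measurable M"
  by (intro borel_measurable_continuous_Pair[OF assms] continuous_intros)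

definition orbit_average :: "(real^'p^'n \<Rightarrow> real) \<Rightarrow> real^'p^'n \<Rightarrow> real" where
  "orbit_average \<phi> Y = (\<integral>G. \<phi> (random_rotation G ** Y) \<partial>std_normal_matrix)"

lemma orbit_average_full_column_rank:
  fixes \<phi> :: "real^'p^'n \<Rightarrow> real"
  assumes inv: "invariant_under G_L \<phi>" and [measurable]: "\<phi> \<in> borel_measurable borel"
    and "inj ((*v) Y)" "inj ((*v) Z)"
  shows "orbit_average \<phi> Y = orbit_average \<phi> Z"
proof -
  have polar: "orbit_average \<phi> Y = orbit_average \<phi> (polar Y)" if "inj ((*v) Y)" for Y
  proof -
    have "\<phi> (random_rotation G ** Y) = \<phi> (random_rotation G ** polar Y)" for G
      using invariant_under_G_L[OF inv invertible_sym_sqrt_gram[OF that]]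
      by (metis matrix_mul_assoc polar_mult_sqrt[OF that])
    then show ?thesis by (simp add: orbit_average_def)
  qed
  obtain H where H: "orthogonal_matrix H" "H ** polar Y = polar Z"
    using orthonormal_columns_transitive polar_orthonormal assms(3,4) by metis
  \<comment> \<open>For invertible \<open>G\<close>, equivariance turns
    \<open>random_rotation G ** H\<close> into \<open>random_rotation (transpose H ** G)\<close>;
    the Gaussian law then absorbs \<open>transpose H\<close>.\<close>
  have "orbit_average \<phi> (polar Z) =
      (\<integral>G. \<phi> (random_rotation (transpose H ** G) ** polar Y) \<partial>std_normal_matrix)"
    unfolding orbit_average_def
  proof (rule integral_cong_AE)
    show "AE G in std_normal_matrix. \<phi> (random_rotation G ** polar Z)
        = \<phi> (random_rotation (transpose H ** G) ** polar Y)"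
      using AE_invertible
      by eventually_elim
         (use H in \<open>simp add: random_rotation_orthogonal_mult matrix_mul_assoc[symmetric]\<close>)
  qed measurable
  also have "\<dots> = orbit_average \<phi> (polar Y)"
    unfolding orbit_average_def
    by (rule integral_std_normal_matrix_orthogonal[of "transpose H"]) (use H in auto)
  finally show ?thesis using polar assms(3,4) by simp
qed

lemma integrable_bounded_01:
  fixes f :: "'a \<Rightarrow> real"
  assumes "prob_space M" "f \<in> borel_measurable M" "\<And>x. f x \<in> {0..1}"
  shows "integrable M f"
proof -
  interpret prob_space M by fact
  show ?thesis
    using assms(2,3) by (intro integrable_const_bound[where B = 1]) auto
qed

lemma integral_orbit_average:
  fixes \<phi> :: "real^'p^'n \<Rightarrow> real" and D :: "real^'n^'n"
  assumes [measurable]: "\<phi> \<in> borel_measurable borel" and range: "\<And>Y. \<phi> Y \<in> {0..1}"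
  shows "(\<integral>Z. orbit_average \<phi> (D ** Z) \<partial>std_normal_matrix) =
    (\<integral>G. \<integral>Z. \<phi> (random_rotation G ** D ** Z) \<partial>std_normal_matrix \<partial>std_normal_matrix)"
proof -
  interpret A: prob_space "std_normal_matrix :: (real^'n^'n) measure"
    by (rule prob_space_std_normal_matrix)
  interpret B: prob_space "std_normal_matrix :: (real^'p^'n) measure"
    by (rule prob_space_std_normal_matrix)
  interpret P: pair_prob_space "std_normal_matrix :: (real^'n^'n) measure"
    "std_normal_matrix :: (real^'p^'n) measure" ..
  have "integrable (std_normal_matrix \<Otimes>\<^sub>M std_normal_matrix)
      (\<lambda>(G, Z :: real^'p^'n). \<phi> (random_rotation G ** D ** Z))"
    using range by (intro integrable_bounded_01 P.prob_space_axioms) (auto simp: split_beta)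
  from P.Fubini_integral[OF this] show ?thesis
    by (simp add: orbit_average_def matrix_mul_assoc)
qed

theorem theorem2:
  fixes \<phi> :: "real^'p^'n \<Rightarrow> real" and \<alpha> :: real
    and \<Sigma> :: "real^'p^'p" and \<Lambda> :: "real^'n^'n"
  assumes "CARD('n) > CARD('p)"
    and "\<phi> \<in> borel_measurable borel"
    and "\<And>Y. \<phi> Y \<in> {0..1}"
    and "invariant_under G_L \<phi>"
    and "normal_expectation \<phi> (mat 1) (mat 1) = \<alpha>"
    and "positive_definite \<Sigma>"
    and "positive_definite \<Lambda>" and "diagonal_matrix \<Lambda>"
    and "\<And>E :: real^'n^'n. orthogonal_matrix E \<Longrightarrow>
           normal_expectation \<phi> \<Sigma> (E ** \<Lambda> ** transpose E) \<ge> \<alpha>"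
  shows "\<forall>E :: real^'n^'n. orthogonal_matrix E \<longrightarrow>
           normal_expectation \<phi> \<Sigma> (E ** \<Lambda> ** transpose E) = \<alpha>"
proof (intro allI impI)
  fix E0 :: "real^'n^'n" assume E0: "orthogonal_matrix E0"
  note [measurable] = assms(2)
  note range = assms(3)
  define D where "D = sym_sqrt \<Lambda>"
  have D: "invertible D"
    unfolding D_def by (intro positive_definite_invertible sym_sqrt assms)
  define f where "f = (\<lambda>E :: real^'n^'n. \<integral>Z. \<phi> (E ** D ** Z) \<partial>std_normal_matrix)"
  \<comment> \<open>The square root of the conjugate is \<open>E ** D ** transpose E\<close>, and
    its last factor is absorbed by the Gaussian law.\<close>
  have f_eq: "normal_expectation \<phi> \<Sigma> (E ** \<Lambda> ** transpose E) = f E" if E: "orthogonal_matrix E" for E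
  proof -
    have "normal_expectation \<phi> \<Sigma> (E ** \<Lambda> ** transpose E)
        = (\<integral>Z. \<phi> (E ** D ** (transpose E ** Z)) \<partial>std_normal_matrix)"
      using assms(2,4,6)
      by (simp add: normal_expectation_G_L_invariant sym_sqrt_orthogonal_conjugate[OF E assms(7)]
          D_def matrix_mul_assoc)
    also have "\<dots> = f E"
      unfolding f_def by (rule integral_std_normal_matrix_orthogonal) (use E in auto)
    finally show ?thesis .
  qed
  have f_ge: "f E \<ge> \<alpha>" if "orthogonal_matrix E" for E
    using assms(9)[OF that] f_eq[OF that] by simp
  have \<alpha>: "(\<integral>Z. \<phi> (random_rotation G ** Z) \<partial>std_normal_matrix) = \<alpha>" for G
    using assms(5) normal_expectation_G_L_invariant[OF assms(4,2) positive_definite_mat_1, of "mat 1"]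
    by (subst integral_std_normal_matrix_orthogonal) (auto simp: orthogonal_random_rotation sym_sqrt_mat_1)
  interpret N: prob_space "std_normal_matrix :: (real^'n^'n) measure"
    by (rule prob_space_std_normal_matrix)
  interpret P: prob_space "std_normal_matrix :: (real^'p^'n) measure"
    by (rule prob_space_std_normal_matrix)
  have full_rank: "AE Z :: real^'p^'n in std_normal_matrix. inj ((*v) Z)"
    using assms(1) by (intro AE_full_column_rank) simp
  \<comment> \<open>A reference matrix: an almost sure property on a probability space holds
    somewhere.\<close>
  obtain Y :: "real^'p^'n" where Y: "inj ((*v) Y)"
    using eventually_happens[OF full_rank] P.ae_filter_bot by blast
  have avg: "orbit_average \<phi> Z = orbit_average \<phi> Y" if "inj ((*v) Z)" for Z
    using that Y assms(2,4) by (intro orbit_average_full_column_rank)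
  have avg_meas[measurable]: "orbit_average \<phi> \<in> borel_measurable borel"
    unfolding orbit_average_def[abs_def] by measurable
  \<comment> \<open>An invertible \<open>A\<close> preserves full column rank, so
    \<open>A = mat 1\<close> and \<open>A = D\<close> yield the same value: the former identifies it
    as \<alpha>, the latter as the mean of \<open>f\<close>.\<close>
  have int: "(\<integral>Z. orbit_average \<phi> (A ** Z) \<partial>std_normal_matrix) = orbit_average \<phi> Y"
    if A: "invertible A" for A :: "real^'n^'n"
  proof -
    have "inj ((*v) (A ** Z))" if "inj ((*v) Z)" for Z :: "real^'p^'n"
      using inj_compose[OF inj_matrix_vector_mult[OF A] that]
      by (simp add: comp_def matrix_vector_mul_assoc)
    then have "AE Z in std_normal_matrix. orbit_average \<phi> (A ** Z) = orbit_average \<phi> Y"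
      using full_rank avg by (auto elim: eventually_mono)
    then have "(\<integral>Z. orbit_average \<phi> (A ** Z) \<partial>std_normal_matrix)
        = (\<integral>(Z :: real^'p^'n). orbit_average \<phi> Y \<partial>std_normal_matrix)"
      by (intro integral_cong_AE) auto
    then show ?thesis by (simp add: P.prob_space[simplified])
  qed
  have "orbit_average \<phi> Y = (\<integral>(G :: real^'n^'n). \<alpha> \<partial>std_normal_matrix)"
    using int[of "mat 1"] integral_orbit_average[OF assms(2) range, of "mat 1"]
    by (simp add: \<alpha> invertible_det_nz)
  then have "(\<integral>G. f (random_rotation G) \<partial>std_normal_matrix) = \<alpha>"
    using int[OF D] integral_orbit_average[OF assms(2) range, of D]
    by (simp add: f_def N.prob_space[simplified])
  moreover have f_meas: "(\<lambda>G. f (random_rotation G)) \<in> borel_measurable borel"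
    unfolding f_def by measurable
  moreover have "f E \<in> {0..1}" for E
  proof -
    have "integrable std_normal_matrix (\<lambda>Z. \<phi> (E ** D ** Z))"
      by (intro integrable_bounded_01 prob_space_std_normal_matrix) (use range in auto)
    then show ?thesis unfolding f_def
      using range P.integral_le_const[of "\<lambda>Z. \<phi> (E ** D ** Z)" 1]
        P.integral_ge_const[of "\<lambda>Z. \<phi> (E ** D ** Z)" 0] by auto
  qed
  then have f_int: "integrable std_normal_matrix (\<lambda>G :: real^'n^'n. f (random_rotation G))"
    using f_meas by (intro integrable_bounded_01 prob_space_std_normal_matrix) auto
  \<comment> \<open>A nonnegative integrand with integral 0 vanishes almost everywhere.\<close>
  ultimately have "(\<integral>G. f (random_rotation G) - \<alpha> \<partial>std_normal_matrix) = 0"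
    by (simp add: N.prob_space[simplified])
  then have "AE G in std_normal_matrix. f (random_rotation G) - \<alpha> = 0"
    using f_int f_ge orthogonal_random_rotation
    by (subst (asm) integral_nonneg_eq_0_iff_AE) auto
  then have ae: "AE G :: real^'n^'n in lborel. G \<in> {G. invertible G} \<longrightarrow> f (random_rotation G) = \<alpha>"
    unfolding AE_std_normal_matrix_iff by eventually_elim simp
  \<comment> \<open>Scaling is right multiplication by a multiple of the identity, hence a
    transformation in \<open>G_L\<close>.\<close>
  have "\<phi> (s *\<^sub>R Y) = \<phi> Y" if "s \<noteq> 0" for s Y
  proof -
    have "Y ** (s *\<^sub>R mat 1) = s *\<^sub>R Y"
      by (simp add: matrix_matrix_mult_def vec_eq_iff mat_def if_distrib cong: if_cong)
    moreover have "invertible (s *\<^sub>R mat 1 :: real^'p^'p)"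
      using that by (intro scalar_invertible) (auto simp: invertible_det_nz)
    ultimately show ?thesis using invariant_under_G_L[OF assms(4)] by metis
  qed
  then have "continuous_on {E. orthogonal_matrix E} f"
    unfolding f_def by (intro continuous_on_rotated_expectation assms(2) range D)
  moreover have "continuous_on {G :: real^'n^'n. invertible G} random_rotation"
    by (rule continuous_on_cong[THEN iffD1, rotated 2, OF continuous_on_transpose[OF continuous_on_polar]])
       (auto simp: random_rotation_def)
  ultimately have "continuous_on {G :: real^'n^'n. invertible G} (\<lambda>G. f (random_rotation G))"
    by (rule continuous_on_compose2) (auto simp: orthogonal_random_rotation)
  moreover have "invertible (transpose E0)"
    using E0 by (auto simp: invertible_def orthogonal_matrix_def)
  \<comment> \<open>An orthogonal matrix is its own polar factor, so the transpose in
    \<open>random_rotation\<close> sends \<open>transpose E0\<close> to \<open>E0\<close>.\<close>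
  ultimately have "f (random_rotation (transpose E0)) = \<alpha>"
    using AE_lborel_continuous_eq[OF ae open_invertible] by simp
  moreover have "random_rotation (transpose E0) = E0"
    using \<open>invertible (transpose E0)\<close> E0 by (simp add: random_rotation_def polar_orthogonal_matrix)
  ultimately show "normal_expectation \<phi> \<Sigma> (E0 ** \<Lambda> ** transpose E0) = \<alpha>"
    using f_eq[OF E0] by simp
qed

end
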